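(* There exists a real number $\theta<2/3$ such that for all positive integers $r,s,t$, every 2-increasing sequence of triples from $[r]\times[s]\times[t]$ has length at most $(rst)^{\theta}$.
   Context: $[m]=\{1,\dots,m\}$. For integer triples $a=(a_1,a_2,a_3)$ and $b=(b_1,b_2,b_3)$, write $a<_2b$ if $a_i<b_i$ for at least two indices $i\in\{1,2,3\}$. A sequence $a^1,\dots,a^m$ of triples is 2-increasing if $a^i<_2a^j$ whenever $i<j$. *)

theory Defs
  imports Complex_Main
begin

type_synonym triple = "int \<times> int \<times> int"

definition coord :: "triple \<Rightarrow> nat \<Rightarrow> int" where
  "coord a i = (case a of (a1, a2, a3) \<Rightarrow> if i = 1 then a1 else if i = 2 then a2 else a3)"

definition less2 :: "triple \<Rightarrow> triple \<Rightarrow> bool" (infix "<\<^sub>2" 50) where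
  "a <\<^sub>2 b \<longleftrightarrow> card {i \<in> {1, 2, 3}. coord a i < coord b i} \<ge> 2"

definition two_increasing :: "triple list \<Rightarrow> bool" where
  "two_increasing xs \<longleftrightarrow>
     (\<forall>i j. i < j \<and> j < length xs \<longrightarrow> xs ! i <\<^sub>2 xs ! j)"

lemma less2_iff:
  "(a1, a2, a3) <\<^sub>2 (b1, b2, b3) \<longleftrightarrow>
     a1 < b1 \<and> a2 < b2 \<or> a1 < b1 \<and> a3 < b3 \<or> a2 < b2 \<and> a3 < b3"
proof -
  have "{i \<in> {1, 2, 3::nat}. coord (a1, a2, a3) i < coord (b1, b2, b3) i} =
      (if a1 < b1 then {1} else {}) \<union> (if a2 < b2 then {2} else {}) \<union> (if a3 < b3 then {3} else {})"
    by (auto simp: coord_def split: if_splits)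
  then show ?thesis
    by (simp add: less2_def)
qed

lemma two_increasing_iff_sorted_wrt: "two_increasing xs \<longleftrightarrow> sorted_wrt (<\<^sub>2) xs"
  by (auto simp: two_increasing_def sorted_wrt_iff_nth_less)

end

theory Submission
  imports Defs
begin

text \<open>
  Two triples of a 2-increasing sequence never share two coordinates, so the length is at most
  \<open>min {r s, s t, t r} \<le> (r s t)\<^bsup>2/3\<^esup>\<close>. The gain comes from two facts.

  First, the length in \<open>[n]\<^sup>3\<close> is \<open>o(n\<^sup>2)\<close>. If the sequence has positive density, pick an element
  \<open>a = (x, y, z)\<close> such that at some scale the slice with first coordinate \<open>x\<close> (elements \<open>b\<^sub>p\<close>) and the
  slice with third coordinate \<open>z\<close> (elements \<open>c\<^sub>p\<close>) both meet each of \<open>P\<close> consecutive intervals of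
  second coordinates above \<open>y\<close>. The elements that share the second coordinate of \<open>c\<^sub>p\<close> and lie below
  \<open>b\<^bsub>p+1\<^esub>\<close> in the third coordinate precede \<open>b\<^bsub>p+1\<^esub>\<close>, which precedes \<open>c\<^bsub>p+2\<^esub>\<close>. As their third
  coordinates are at least \<open>z\<close>, their first coordinates are smaller than that of \<open>c\<^bsub>p+2\<^esub>\<close>. There are
  many of them, so the first coordinate of \<open>c\<^sub>p\<close> grows quadratically in \<open>p\<close>; but by density it
  can only grow linearly.

  Second, a bound \<open>C (r s t)\<^sup>\<theta>\<close> with \<open>\<theta> < 2/3\<close>, where \<open>r\<close>, \<open>s\<close>, \<open>t\<close> count the values taken
  by the three coordinates, is proved by induction: cut the coordinate sets into \<open>K\<close> intervals each. By induction a cell that uses fractions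
  \<open>a\<close>, \<open>b\<close>, \<open>c\<close> of its three sides has relative size about \<open>K\<^bsup>-2\<^esup> (a b c)\<^sup>\<theta>\<close>, while the fractions sum to
  at most \<open>K\<^sup>2\<close> over all cells. Hence in a counterexample a positive proportion of \<open>K\<^sup>2\<close> cells
  have \<open>a, b, c\<close> bounded below, and a positive proportion of those cells forms a 2-increasing sequence in
  \<open>[K]\<^sup>3\<close>, which contradicts the first fact. The constant \<open>C\<close> disappears on taking lexicographic powers.
\<close>

section \<open>Sequences with three coordinate functions\<close>

text \<open>
  A sequence is represented by its set of indices and three coordinate functions; this makes the
  statements symmetric in the coordinates and allows them to be coarsened on the same indices.
\<close>

definition inc2 :: "(nat \<Rightarrow> nat) \<Rightarrow> (nat \<Rightarrow> nat) \<Rightarrow> (nat \<Rightarrow> nat) \<Rightarrow> nat set \<Rightarrow> bool" where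
  "inc2 f g h S \<longleftrightarrow> (\<forall>i\<in>S. \<forall>j\<in>S. i < j \<longrightarrow>
     f i < f j \<and> g i < g j \<or> f i < f j \<and> h i < h j \<or> g i < g j \<and> h i < h j)"

lemma inc2_rotate: "inc2 f g h S \<Longrightarrow> inc2 g h f S"
  unfolding inc2_def by blast

lemma inc2_swap: "inc2 f g h S \<Longrightarrow> inc2 f h g S"
  unfolding inc2_def by blast

lemma inc2_subset: "inc2 f g h S \<Longrightarrow> T \<subseteq> S \<Longrightarrow> inc2 f g h T"
  unfolding inc2_def by blast

text \<open>If \<open>j < i\<close>, then two of the three coordinates rise strictly from
  \<open>j\<close> to \<open>i\<close>, so \<open>f\<close> or \<open>g\<close> does, against the
  weak inequalities. This recovers the index order from two coordinates.\<close>

lemma inc2_before: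
  assumes "inc2 f g h S" "i \<in> S" "j \<in> S" "f i \<le> f j" "g i \<le> g j" "f i < f j \<or> g i < g j"
  shows "i < j"
proof (rule ccontr)
  assume "\<not> i < j"
  then have "j < i \<or> i = j" by auto
  then show False
    using assms unfolding inc2_def by fastforce
qed

lemma inc2_same:
  assumes "inc2 f g h S" "i \<in> S" "j \<in> S" "f i = f j" "i < j"
  shows "g i < g j" "h i < h j"
  using assms unfolding inc2_def by fastforce+

lemma inc2_eq:
  assumes "inc2 f g h S" "i \<in> S" "j \<in> S" "f i = f j" "g i = g j"
  shows "i = j"
  using inc2_same[of f g h S i j] inc2_same[of f g h S j i] assms
  by (metis less_irrefl linorder_less_linear)

lemma inc2_third:
  assumes "inc2 f g h S" "i \<in> S" "j \<in> S" "i < j" "h j \<le> h i"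
  shows "f i < f j" "g i < g j"
  using assms unfolding inc2_def by fastforce+

text \<open>Only the \<open>g\<close>-values of the line \<open>f = x\<close> are kept; on a
  2-increasing sequence this loses nothing, since \<open>g\<close> is injective on the line by
  \<open>inc2_eq\<close>.\<close>

definition slice :: "(nat \<Rightarrow> nat) \<Rightarrow> (nat \<Rightarrow> nat) \<Rightarrow> nat set \<Rightarrow> nat \<Rightarrow> nat set" where
  "slice f g S x = g ` {i \<in> S. f i = x}"

text \<open>One-sided density on all windows starting at \<open>a\<close> simultaneously, so that
  any length produced later by the sequence itself converts into a number of elements.\<close>

definition rich :: "real \<Rightarrow> nat \<Rightarrow> nat set \<Rightarrow> nat \<Rightarrow> bool" where
  "rich \<delta> n B a \<longleftrightarrow> (\<forall>k\<le>n. \<delta> * real k \<le> real (card (B \<inter> {a..<a+k})))"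

definition fine :: "nat \<Rightarrow> nat \<Rightarrow> nat set \<Rightarrow> nat \<Rightarrow> bool" where
  "fine P w B a \<longleftrightarrow> (\<forall>p<P. B \<inter> {a + p * w..<a + (p + 1) * w} \<noteq> {})"

section \<open>Dense sequences\<close>

text \<open>A greedy covering from left to right: the first poor point has a window with fewer than
  \<delta> \<open>k\<close> elements of \<open>B\<close> among \<open>k\<close> positions; continue
  with the first poor point after this window. The windows are disjoint, start below
  \<open>n\<close> and have length at most \<open>n\<close>, so they lie below \<open>2 * n\<close>
  and contain at most 2 \<delta> \<open>n\<close> elements.\<close>

lemma card_poor_le:
  assumes B: "B \<subseteq> {..<n}" and \<delta>: "\<delta> \<ge> 0"
  shows "real (card {a \<in> B. \<not> rich \<delta> n B a}) \<le> 2 * \<delta> * real n"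
proof -
  define Q where "Q = {a \<in> B. \<not> rich \<delta> n B a}"
  have finB: "finite B" using B finite_subset by blast
  have finQ: "finite Q" unfolding Q_def using finB by auto
  have "real (card (Q \<inter> {s..})) \<le> \<delta> * (2 * real n - real s)" if "s \<le> 2 * n" for s
    using that
  proof (induction "2 * n - s" arbitrary: s rule: less_induct)
    case less
    show ?case
    proof (cases "Q \<inter> {s..} = {}")
      case True
      have "0 \<le> \<delta> * (2 * real n - real s)"
        using \<delta> less.prems by (intro mult_nonneg_nonneg) linarith+
      then show ?thesis unfolding True by simp
    next
      case False
      define a where "a = Min (Q \<inter> {s..})"
      have a: "a \<in> Q" "s \<le> a"
        using Min_in[of "Q \<inter> {s..}"] False finQ unfolding a_def by auto
      have amin: "a \<le> b" if "b \<in> Q" "s \<le> b" for b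
        using that finQ unfolding a_def by (intro Min_le) auto
      obtain k where k: "k \<le> n" "real (card (B \<inter> {a..<a+k})) < \<delta> * real k"
        using a(1) unfolding Q_def rich_def by (auto simp: not_le)
      have "k > 0" using k by (cases k) auto
      have "a < n" using a(1) B unfolding Q_def by auto
      have sub: "Q \<inter> {s..} \<subseteq> (B \<inter> {a..<a+k}) \<union> (Q \<inter> {a+k..})"
        using amin unfolding Q_def by force
      have "card (Q \<inter> {s..}) \<le> card ((B \<inter> {a..<a+k}) \<union> (Q \<inter> {a+k..}))"
        by (rule card_mono[OF _ sub]) (use finB finQ in auto)
      also have "\<dots> \<le> card (B \<inter> {a..<a+k}) + card (Q \<inter> {a+k..})"
        by (rule card_Un_le)
      finally have 1: "real (card (Q \<inter> {s..})) \<le> real (card (B \<inter> {a..<a+k})) + real (card (Q \<inter> {a+k..}))"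
        by linarith
      have 2: "real (card (Q \<inter> {a+k..})) \<le> \<delta> * (2 * real n - real (a+k))"
        by (rule less.hyps) (use \<open>k > 0\<close> \<open>a < n\<close> k a in auto)
      have "real (card (Q \<inter> {s..})) \<le> \<delta> * real k + \<delta> * (2 * real n - real (a+k))"
        using 1 2 k by linarith
      also have "\<dots> = \<delta> * (2 * real n - real a)"
        by (simp add: algebra_simps)
      also have "\<dots> \<le> \<delta> * (2 * real n - real s)"
        using a \<delta> by (intro mult_left_mono) auto
      finally show ?thesis .
    qed
  qed
  from this[of 0] show ?thesis unfolding Q_def by (simp add: mult.commute mult.left_commute)
qed

text \<open>A geometric series is dominated by its largest term, here the largest admissible power
  of two. It sums the charges to one gap over all scales.\<close>

lemma sum_pow2_le: "(\<Sum>i<D. if 2 ^ i \<le> N then 2 ^ i else 0 :: nat) \<le> 2 * N"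
proof (induction D)
  case (Suc D)
  show ?case
  proof (cases "2 ^ D \<le> N")
    case True
    have "(\<Sum>i<Suc D. if 2 ^ i \<le> N then 2 ^ i else 0) \<le> (\<Sum>i<Suc D. 2 ^ i :: nat)"
      by (intro sum_mono) auto
    also have "\<dots> \<le> 2 ^ Suc D"
      using sum_power2[of "Suc D"] by (simp add: lessThan_atLeast0)
    finally show ?thesis using True by simp
  next
    case False
    then show ?thesis using Suc by simp
  qed
qed simp

text \<open>
  Each failure at scale \<open>2\<^sup>i\<close> is charged to a nearby gap of \<open>B\<close> of length at least \<open>2\<^sup>i\<close>; the charges to a
  gap form a geometric series over the scales, so the total is linear in the sum of the gaps.
\<close>

lemma sum_card_not_fine_le:
  assumes B: "B \<subseteq> {..<n}" and D: "\<And>i. i < D \<Longrightarrow> 2 ^ i \<le> n"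
  shows "(\<Sum>i<D. card {a \<in> B. \<not> fine P (2 ^ i) B a}) \<le> 4 * P * n"
proof -
  \<comment> \<open>\<open>N b\<close> is the gap from \<open>b\<close> to the next element of
    \<open>B\<close>. The cut at \<open>2 * n\<close> rather than \<open>n\<close> leaves room for a
    block of length at most \<open>n\<close> behind the last element; the gaps are disjoint, so
    their sizes sum to at most \<open>2 * n\<close>.\<close>
  define N where "N b = {y. b < y \<and> y < 2 * n \<and> B \<inter> {b<..y} = {}}" for b
  have finB: "finite B" using B finite_subset by blast
  have finN: "finite (N b)" for b
    by (rule finite_subset[of _ "{..<2*n}"]) (auto simp: N_def)
  have "card {a \<in> B. \<not> fine P (2 ^ i) B a} \<le> (\<Sum>b\<in>B. if 2 ^ i \<le> card (N b) then P * 2 ^ i else 0)"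
    if i: "i < D" for i
  proof -
    define w :: nat where "w = 2 ^ i"
    have w: "w > 0" "w \<le> n" unfolding w_def using D[OF i] by auto
    define B' where "B' = {b \<in> B. w \<le> card (N b)}"
    have sub: "{a \<in> B. \<not> fine P w B a} \<subseteq> (\<Union>b\<in>B'. {b + 1 - P * w..<b + 1})"
    proof
      fix a assume "a \<in> {a \<in> B. \<not> fine P w B a}"
      then obtain p where a: "a \<in> B" and p: "p < P" and e: "B \<inter> {a + p * w..<a + (p + 1) * w} = {}"
        unfolding fine_def by auto
      have p0: "p > 0"
      proof (rule ccontr)
        assume "\<not> p > 0"
        then have "a \<in> B \<inter> {a + p * w..<a + (p + 1) * w}" using a w by auto
        then show False using e by auto
      qed
      \<comment> \<open>\<open>b\<close> is the last element before the empty block. Its gap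
        contains at least \<open>w\<close> positions, and \<open>a\<close> is one of the
        \<open>P * w\<close> positions ending at \<open>b\<close>; hence each gap is charged at most
        \<open>P * w\<close> times at this scale.\<close>
      define b where "b = Max (B \<inter> {a..<a + p * w})"
      have ne: "a \<in> B \<inter> {a..<a + p * w}" using a p0 w by auto
      have "b \<in> B \<inter> {a..<a + p * w}"
        unfolding b_def using ne finB by (intro Max_in) auto
      then have b: "b \<in> B" "a \<le> b" "b < a + p * w" by auto
      have bmax: "y \<le> b" if "y \<in> B" "y < a + p * w" for y
      proof (cases "a \<le> y")
        case True
        then show ?thesis using that finB unfolding b_def by (intro Max_ge) auto
      qed (use b in auto)
      have empt: "y \<notin> B" if "b < y" "y < a + (p+1) * w" for y
        using that bmax[of y] e by (cases "y < a + p * w") auto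
      have "b < n" using b B by auto
      have "{b<..b+w} \<subseteq> N b"
        unfolding N_def using \<open>b < n\<close> w b empt by (auto simp: algebra_simps)
      then have "w \<le> card (N b)"
        using card_mono[OF finN] by (metis add_diff_cancel_left' card_greaterThanAtMost)
      then have "b \<in> B'" using b unfolding B'_def by auto
      moreover have "(p + 1) * w \<le> P * w" using p by (intro mult_right_mono) auto
      then have "a \<in> {b + 1 - P * w..<b + 1}" using b by (auto simp: algebra_simps)
      ultimately show "a \<in> (\<Union>b\<in>B'. {b + 1 - P * w..<b + 1})" by blast
    qed
    have "finite B'" unfolding B'_def using finB by auto
    have "card {a \<in> B. \<not> fine P w B a} \<le> card (\<Union>b\<in>B'. {b + 1 - P * w..<b + 1})"
      by (rule card_mono[OF _ sub]) (use \<open>finite B'\<close> in auto)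
    also have "\<dots> \<le> (\<Sum>b\<in>B'. card {b + 1 - P * w..<b + 1})"
      by (rule card_UN_le[OF \<open>finite B'\<close>])
    also have "\<dots> \<le> (\<Sum>b\<in>B'. P * w)"
      by (intro sum_mono) auto
    also have "\<dots> = (\<Sum>b\<in>B. if w \<le> card (N b) then P * w else 0)"
      unfolding B'_def by (rule sum.inter_filter[OF finB])
    finally show ?thesis unfolding w_def .
  qed
  then have "(\<Sum>i<D. card {a \<in> B. \<not> fine P (2 ^ i) B a})
      \<le> (\<Sum>i<D. \<Sum>b\<in>B. if 2 ^ i \<le> card (N b) then P * 2 ^ i else 0)"
    by (intro sum_mono) auto
  also have "\<dots> = (\<Sum>b\<in>B. \<Sum>i<D. if 2 ^ i \<le> card (N b) then P * 2 ^ i else 0)"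
    by (rule sum.swap)
  also have "\<dots> = (\<Sum>b\<in>B. P * (\<Sum>i<D. if 2 ^ i \<le> card (N b) then 2 ^ i else 0))"
    by (intro sum.cong refl) (auto simp: sum_distrib_left intro!: sum.cong)
  also have "\<dots> \<le> (\<Sum>b\<in>B. P * (2 * card (N b)))"
    by (intro sum_mono mult_left_mono sum_pow2_le) auto
  also have "\<dots> = 2 * P * (\<Sum>b\<in>B. card (N b))"
    by (simp add: sum_distrib_left mult_ac)
  also have "(\<Sum>b\<in>B. card (N b)) = card (\<Union>b\<in>B. N b)"
  proof (rule card_UN_disjoint[symmetric])
    show "\<forall>i\<in>B. \<forall>j\<in>B. i \<noteq> j \<longrightarrow> N i \<inter> N j = {}"
    proof (intro ballI impI)
      fix i j assume ij: "i \<in> B" "j \<in> B" "i \<noteq> j"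
      have "False" if "y \<in> N i" "y \<in> N j" for y
      proof (cases "i < j")
        case True
        then have "j \<in> B \<inter> {i<..y}" using that ij by (auto simp: N_def)
        then show ?thesis using that by (auto simp: N_def)
      next
        case False
        then have "i \<in> B \<inter> {j<..y}" using that ij by (auto simp: N_def)
        then show ?thesis using that by (auto simp: N_def)
      qed
      then show "N i \<inter> N j = {}" by blast
    qed
  qed (use finB finN in auto)
  also have "card (\<Union>b\<in>B. N b) \<le> card {..<2*n}"
    by (intro card_mono) (auto simp: N_def)
  finally show ?thesis by simp
qed

section \<open>Slices of a 2-increasing sequence and the subquadratic bound\<close>

lemma card_slice_pred:
  assumes "finite S" "f ` S \<subseteq> {..<n}"
    and inj: "\<And>i j. i \<in> S \<Longrightarrow> j \<in> S \<Longrightarrow> f i = f j \<Longrightarrow> g i = g j \<Longrightarrow> i = j"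
  shows "card {a \<in> S. Q (slice f g S (f a)) (g a)} = (\<Sum>x<n. card {y \<in> slice f g S x. Q (slice f g S x) y})"
proof -
  have "{a \<in> S. Q (slice f g S (f a)) (g a)} = (\<Union>x\<in>{..<n}. {a \<in> S. f a = x \<and> Q (slice f g S x) (g a)})"
    using assms(2) by auto
  also have "card \<dots> = (\<Sum>x<n. card {a \<in> S. f a = x \<and> Q (slice f g S x) (g a)})"
    by (rule card_UN_disjoint) (use assms(1) in auto)
  also have "\<dots> = (\<Sum>x<n. card {y \<in> slice f g S x. Q (slice f g S x) y})"
  proof (rule sum.cong[OF refl])
    fix x
    have "{y \<in> slice f g S x. Q (slice f g S x) y} = g ` {a \<in> S. f a = x \<and> Q (slice f g S x) (g a)}"
      by (auto simp: slice_def)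
    moreover have "inj_on g {a \<in> S. f a = x \<and> Q (slice f g S x) (g a)}"
      using inj by (auto simp: inj_on_def)
    ultimately show "card {a \<in> S. f a = x \<and> Q (slice f g S x) (g a)} = card {y \<in> slice f g S x. Q (slice f g S x) y}"
      by (simp add: card_image)
  qed
  finally show ?thesis .
qed

text \<open>The points \<open>b p\<close> (on the \<open>f\<close>-slice of \<open>a\<close>) and
  \<open>c p\<close> (on the \<open>h\<close>-slice of \<open>a\<close>) lie in the
  \<open>p\<close>-th block of second coordinates. The first coordinate of \<open>c\<close> grows by
  at least \<delta>^2 \<open>p * w\<close> over two steps, hence by \<delta>^2 \<open>q\<close>^2
  \<open>w\<close> in total, while richness of the \<open>h\<close>-slice of \<open>a\<close> caps
  the growth at \<open>P * w\<close> / \<delta>. The bound on \<open>q\<close> makes these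
  incompatible. The \<open>c p\<close> are taken in \<open>T\<close> because each step needs the
  \<open>g\<close>-slice through \<open>c p\<close> to be rich.\<close>

lemma no_fine_point:
  assumes inc: "inc2 f g h S" and fin: "finite S"
    and n: "f ` S \<subseteq> {..<n}" "g ` S \<subseteq> {..<n}" "h ` S \<subseteq> {..<n}"
    and \<delta>: "\<delta> > 0" and q: "real q > 4 / \<delta> ^ 3" and w: "w > 0"
    and T: "T = {c \<in> S. rich \<delta> n (slice g h S (g c)) (h c)}"
    and a: "a \<in> S"
    and rich_f: "rich \<delta> n (slice f g S (f a)) (g a)"
    and rich_h: "rich \<delta> n (slice h f S (h a)) (f a)"
    and fine_f: "fine (2 * q + 2) w (slice f g S (f a)) (g a)"
    and fine_h: "fine (2 * q + 2) w (slice h g T (h a)) (g a)"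
  shows False
proof -
  define P where "P = 2 * q + 2"
  have TS: "T \<subseteq> S" using T by auto
  note inc_ghf = inc2_rotate[OF inc]
  note inc_hfg = inc2_rotate[OF inc_ghf]
  note inc_fhg = inc2_swap[OF inc]
  have "\<forall>p<P. \<exists>b\<in>S. f b = f a \<and> g a + p * w \<le> g b \<and> g b < g a + (p + 1) * w"
    using fine_f unfolding fine_def slice_def P_def by force
  then obtain b where b: "\<And>p. p < P \<Longrightarrow> b p \<in> S" "\<And>p. p < P \<Longrightarrow> f (b p) = f a"
      "\<And>p. p < P \<Longrightarrow> g a + p * w \<le> g (b p)" "\<And>p. p < P \<Longrightarrow> g (b p) < g a + (p + 1) * w"
    by metis
  have "\<forall>p<P. \<exists>c\<in>T. h c = h a \<and> g a + p * w \<le> g c \<and> g c < g a + (p + 1) * w"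
    using fine_h unfolding fine_def slice_def P_def by force
  then obtain c where c: "\<And>p. p < P \<Longrightarrow> c p \<in> T" "\<And>p. p < P \<Longrightarrow> h (c p) = h a"
      "\<And>p. p < P \<Longrightarrow> g a + p * w \<le> g (c p)" "\<And>p. p < P \<Longrightarrow> g (c p) < g a + (p + 1) * w"
    by metis
  have cS: "c p \<in> S" if "p < P" for p using c(1)[OF that] TS by auto
  have mono: "(p + 1) * w \<le> p' * w" if "p < p'" for p p'
    using that by (intro mult_right_mono) auto
  have hb: "a < b p" "h a < h (b p)" if "p < P" "p > 0" for p
  proof -
    have "g a < g (b p)" using b(3)[OF that(1)] that w
      by (metis add_lessD1 less_add_same_cancel1 mult_pos_pos order_less_le_trans)
    then show ab: "a < b p"
      using inc2_before[OF inc a b(1)[OF that(1)]] b(2)[OF that(1)] by simp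
    show "h a < h (b p)"
      using inc2_same(2)[OF inc a b(1)[OF that(1)] _ ab] b(2)[OF that(1)] by simp
  qed
  have fc: "f a < f (c p)" if "p < P" "p > 0" for p
  proof -
    have "g a < g (c p)" using c(3)[OF that(1)] that w
      by (metis add_lessD1 less_add_same_cancel1 mult_pos_pos order_less_le_trans)
    then have ac: "a < c p"
      using inc2_before[OF inc_ghf a cS[OF that(1)]] c(2)[OF that(1)] by simp
    show ?thesis
      using inc2_same(1)[OF inc_hfg a cS[OF that(1)] _ ac] c(2)[OF that(1)] by simp
  qed
  have b_before_c: "b p < c p'" if "p < p'" "p' < P" for p p'
  proof (rule inc2_before[OF inc])
    have "p < P" using that by simp
    show "b p \<in> S" "c p' \<in> S" using b cS that \<open>p < P\<close> by auto
    have "g (b p) < g (c p')"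
      using b(4)[OF \<open>p < P\<close>] c(3)[OF that(2)] mono[OF that(1)] by linarith
    moreover have "f (b p) \<le> f (c p')" using b(2)[OF \<open>p < P\<close>] fc[OF that(2)] that by auto
    ultimately show "g (b p) \<le> g (c p')" "f (b p) \<le> f (c p')" "f (b p) < f (c p') \<or> g (b p) < g (c p')"
      by auto
  qed
  have step: "real (f (c (p + 2))) \<ge> real (f (c p)) + \<delta>\<^sup>2 * (real p * real w)" if p: "p + 2 < P" for p
  proof -
    have p': "p < P" "p + 1 < P" using p by auto
    \<comment> \<open>The elements of \<open>E\<close> have distinct first coordinates, all from
      \<open>f (c p)\<close> up to below \<open>f (c (p + 2))\<close>, so a lower bound on
      \<open>card E\<close> is a lower bound on the growth.\<close>
    define E where "E = {i \<in> S. g i = g (c p) \<and> h a \<le> h i \<and> h i < h (b (p + 1))}"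
    have finE: "finite E" unfolding E_def using fin by auto
    have E1: "f (c p) \<le> f e \<and> f e < f (c (p + 2))" if e: "e \<in> E" for e
    proof -
      have eS: "e \<in> S" and ge: "g e = g (c p)" and he: "h a \<le> h e" "h e < h (b (p + 1))"
        using e unfolding E_def by auto
      have "g e < g (b (p + 1))"
        using c(4)[OF p'(1)] b(3)[OF p'(2)] ge by auto
      then have "e < b (p + 1)"
        using inc2_before[OF inc_ghf eS b(1)[OF p'(2)]] he by auto
      moreover have "b (p + 1) < c (p + 2)" by (rule b_before_c) (use p in auto)
      ultimately have "e < c (p + 2)" by simp
      then have 1: "f e < f (c (p + 2))"
        using inc2_third(1)[OF inc eS cS[OF p]] he c(2)[OF p] by auto
      have "f (c p) \<le> f e"
      proof (cases "e = c p")
        case False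
        have "c p < e"
        proof (rule ccontr)
          assume "\<not> c p < e"
          then have "e < c p" using False by auto
          then have "h e < h (c p)" using inc2_same(1)[OF inc_ghf eS cS[OF p'(1)] ge] by auto
          then show False using he c(2)[OF p'(1)] by auto
        qed
        then show ?thesis using inc2_same(2)[OF inc_ghf cS[OF p'(1)] eS ge[symmetric]] by auto
      qed auto
      then show ?thesis using 1 by simp
    qed
    have injE: "inj_on f E"
      using inc2_eq[OF inc] unfolding inj_on_def E_def by auto
    have "card E = card (f ` E)" using injE by (simp add: card_image)
    also have "\<dots> \<le> card {f (c p)..<f (c (p + 2))}"
      by (intro card_mono) (use E1 in auto)
    finally have cE: "real (card E) \<le> real (f (c (p + 2)) - f (c p))" by simp
    have cpE: "c p \<in> E"
      unfolding E_def using cS[OF p'(1)] c(2)[OF p'(1)] hb(2)[OF p'(2)] by auto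
    have less: "f (c p) < f (c (p + 2))" using E1[OF cpE] by simp
    define k where "k = h (b (p + 1)) - h a"
    have kn: "k \<le> n" unfolding k_def using n(3) b(1)[OF p'(2)] by (auto simp: image_subset_iff dest!: bspec)
    have "\<delta> * real k \<le> real (card (slice g h S (g (c p)) \<inter> {h a..<h a + k}))"
      using c(1)[OF p'(1)] c(2)[OF p'(1)] kn unfolding T rich_def by auto
    also have "slice g h S (g (c p)) \<inter> {h a..<h a + k} \<subseteq> h ` E"
      unfolding slice_def E_def k_def by auto
    then have "card (slice g h S (g (c p)) \<inter> {h a..<h a + k}) \<le> card E"
      using card_mono[of "h ` E"] card_image_le[OF finE, of h] finE by (meson finite_imageI le_trans)
    finally have E2: "\<delta> * real k \<le> real (card E)" by simp
    define l where "l = g (b (p + 1)) - g a"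
    have ln: "l \<le> n" unfolding l_def using n(2) b(1)[OF p'(2)] by (auto simp: image_subset_iff dest!: bspec)
    \<comment> \<open>This set bounds the height \<open>k\<close> of \<open>E\<close> from below:
      the rich \<open>f\<close>-slice of \<open>a\<close> has at least \<delta> \<open>l\<close>
      elements before \<open>b (p + 1)\<close>, and their third coordinates are distinct and fit
      into a window of length \<open>k\<close>.\<close>
    define F where "F = {i \<in> S. f i = f a \<and> g a \<le> g i \<and> g i < g (b (p + 1))}"
    have finF: "finite F" unfolding F_def using fin by auto
    have F1: "h a \<le> h e \<and> h e < h (b (p + 1))" if e: "e \<in> F" for e
    proof -
      have eS: "e \<in> S" and fe: "f e = f a" and ge: "g a \<le> g e" "g e < g (b (p + 1))"
        using e unfolding F_def by auto
      have fb: "f e = f (b (p + 1))" using fe b(2)[OF p'(2)] by simp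
      have "e < b (p + 1)"
        using inc2_before[OF inc eS b(1)[OF p'(2)]] fb ge by auto
      then have 1: "h e < h (b (p + 1))" using inc2_same(2)[OF inc eS b(1)[OF p'(2)] fb] by simp
      have "h a \<le> h e"
      proof (cases "g a = g e")
        case True
        then have "a = e" using inc2_eq[OF inc a eS] fe by simp
        then show ?thesis by simp
      next
        case False
        then have "a < e" using inc2_before[OF inc a eS] fe ge by auto
        then show ?thesis using inc2_same(2)[OF inc a eS] fe by auto
      qed
      then show ?thesis using 1 by simp
    qed
    have injF: "inj_on h F"
      using inc2_eq[OF inc_fhg] unfolding inj_on_def F_def by auto
    have "card F = card (h ` F)" using injF by (simp add: card_image)
    also have "\<dots> \<le> card {h a..<h (b (p + 1))}"
      by (intro card_mono) (use F1 in auto)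
    finally have cF: "real (card F) \<le> real k" unfolding k_def by simp
    have "\<delta> * real l \<le> real (card (slice f g S (f a) \<inter> {g a..<g a + l}))"
      using rich_f ln unfolding rich_def by auto
    also have "slice f g S (f a) \<inter> {g a..<g a + l} \<subseteq> g ` F"
      unfolding slice_def F_def l_def by auto
    then have "card (slice f g S (f a) \<inter> {g a..<g a + l}) \<le> card F"
      using card_mono[of "g ` F"] card_image_le[OF finF, of g] finF by (meson finite_imageI le_trans)
    finally have F2: "\<delta> * real l \<le> real (card F)" by simp
    have "p * w \<le> l" using b(3)[OF p'(2)] unfolding l_def by (auto simp: algebra_simps)
    then have "real p * real w \<le> real l" by (metis of_nat_le_iff of_nat_mult)
    then have "\<delta> * (real p * real w) \<le> \<delta> * real l" using \<delta> by simp
    also have "\<dots> \<le> real k" using F2 cF by linarith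
    finally have "\<delta> * (\<delta> * (real p * real w)) \<le> \<delta> * real k" using \<delta> by simp
    also have "\<dots> \<le> real (f (c (p + 2)) - f (c p))" using E2 cE by linarith
    finally show ?thesis using less by (simp add: power2_eq_square algebra_simps of_nat_diff)
  qed
  \<comment> \<open>Only odd indices are used, as a step advances by two; the increments
    \<open>2 * j + 1\<close> sum to a square. The start is \<open>c 1\<close>, since
    \<open>fc\<close> needs a positive index.\<close>
  have up: "real (f (c (2 * j + 1))) \<ge> real (f a) + \<delta>\<^sup>2 * (real j)\<^sup>2 * real w" if "j \<le> q" for j
    using that
  proof (induction j)
    case 0
    have "f a < f (c 1)" by (rule fc) (auto simp: P_def)
    then show ?case by simp
  next
    case (Suc j)
    have "real (f (c (2 * j + 1 + 2))) \<ge> real (f (c (2 * j + 1))) + \<delta>\<^sup>2 * (real (2 * j + 1) * real w)"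
      by (rule step) (use Suc in \<open>auto simp: P_def\<close>)
    moreover have "2 * j + 1 + 2 = 2 * Suc j + 1" by simp
    ultimately show ?case using Suc by (simp add: algebra_simps power2_eq_square)
  qed
  define e where "e = c (2 * q + 1)"
  have pq: "2 * q + 1 < P" unfolding P_def by simp
  have eS: "e \<in> S" and he: "h e = h a" unfolding e_def using cS[OF pq] c(2)[OF pq] by auto
  have ge: "g e < g a + P * w" using c(4)[OF pq] unfolding e_def P_def by simp
  define k where "k = f e - f a"
  have kn: "k \<le> n" unfolding k_def using n(1) eS by (auto simp: image_subset_iff dest!: bspec)
  \<comment> \<open>The upper bound: these elements of the \<open>h\<close>-slice of
    \<open>a\<close> precede \<open>e\<close>, so their distinct second coordinates lie in a window
    of length \<open>P * w\<close>; richness then gives \<delta> \<open>k\<close> \<le>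
    \<open>P * w\<close>.\<close>
  define F where "F = {i \<in> S. h i = h a \<and> f a \<le> f i \<and> f i < f e}"
  have finF: "finite F" unfolding F_def using fin by auto
  have F1: "g a \<le> g i \<and> g i < g a + P * w" if i: "i \<in> F" for i
  proof -
    have iS: "i \<in> S" and hi: "h i = h a" and fi: "f a \<le> f i" "f i < f e"
      using i unfolding F_def by auto
    have "i < e" using inc2_before[OF inc_hfg iS eS] hi he fi by auto
    then have "g i < g e" using inc2_same(2)[OF inc_hfg iS eS] hi he by auto
    moreover have "g a \<le> g i"
    proof (cases "f a = f i")
      case True
      then have "a = i" using inc2_eq[OF inc_hfg a iS] hi by simp
      then show ?thesis by simp
    next
      case False
      then have "a < i" using inc2_before[OF inc_hfg a iS] hi fi by auto
      then show ?thesis using inc2_same(2)[OF inc_hfg a iS] hi by auto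
    qed
    ultimately show ?thesis using ge by simp
  qed
  have injF: "inj_on g F"
    using inc2_eq[OF inc_ghf] unfolding inj_on_def F_def by auto
  have "card F = card (g ` F)" using injF by (simp add: card_image)
  also have "\<dots> \<le> card {g a..<g a + P * w}"
    by (intro card_mono) (use F1 in auto)
  finally have cF: "real (card F) \<le> real P * real w" by (metis add_diff_cancel_left' card_atLeastLessThan of_nat_le_iff of_nat_mult)
  have "\<delta> * real k \<le> real (card (slice h f S (h a) \<inter> {f a..<f a + k}))"
    using rich_h kn unfolding rich_def by auto
  also have "slice h f S (h a) \<inter> {f a..<f a + k} \<subseteq> f ` F"
    unfolding slice_def F_def k_def by auto
  then have "card (slice h f S (h a) \<inter> {f a..<f a + k}) \<le> card F"
    using card_mono[of "f ` F"] card_image_le[OF finF, of f] finF by (meson finite_imageI le_trans)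
  finally have F2: "\<delta> * real k \<le> real P * real w" using cF by simp
  have "\<delta>\<^sup>2 * (real q)\<^sup>2 * real w \<le> real k"
    using up[of q] unfolding k_def e_def by (simp add: le_diff_conv)
  then have "\<delta> * (\<delta>\<^sup>2 * (real q)\<^sup>2 * real w) \<le> \<delta> * real k" using \<delta> by simp
  also have "\<dots> \<le> real P * real w" by (rule F2)
  finally have "\<delta> * (\<delta>\<^sup>2 * (real q)\<^sup>2) * real w \<le> real P * real w" by (simp add: mult_ac)
  then have 3: "\<delta> * (\<delta>\<^sup>2 * (real q)\<^sup>2) \<le> real P" using w by simp
  have q0: "real q > 0" using q \<delta> by (smt (verit) divide_pos_pos zero_less_power)
  then have "q \<ge> 1" by simp
  then have "real P \<le> 4 * real q" unfolding P_def by simp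
  then have "(\<delta> ^ 3 * real q) * real q \<le> 4 * real q" using 3 by (simp add: power2_eq_square power3_eq_cube mult_ac)
  then have "\<delta> ^ 3 * real q \<le> 4" using q0 by simp
  moreover have "4 < \<delta> ^ 3 * real q" using q \<delta> by (simp add: divide_less_eq mult.commute)
  ultimately show False by simp
qed

lemma card_slice_poor_le:
  assumes inc: "inc2 f g h S" and fin: "finite S" and n: "f ` S \<subseteq> {..<n}" "g ` S \<subseteq> {..<n}"
    and \<delta>: "\<delta> \<ge> 0"
  shows "real (card {a \<in> S. \<not> rich \<delta> n (slice f g S (f a)) (g a)}) \<le> 2 * \<delta> * (real n)\<^sup>2"
proof -
  have "card {a \<in> S. \<not> rich \<delta> n (slice f g S (f a)) (g a)} =
      (\<Sum>x<n. card {y \<in> slice f g S x. \<not> rich \<delta> n (slice f g S x) y})"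
    by (rule card_slice_pred[where Q = "\<lambda>B a. \<not> rich \<delta> n B a", OF fin n(1) inc2_eq[OF inc]])
  then have "real (card {a \<in> S. \<not> rich \<delta> n (slice f g S (f a)) (g a)}) =
      (\<Sum>x<n. real (card {y \<in> slice f g S x. \<not> rich \<delta> n (slice f g S x) y}))"
    by (simp only: of_nat_sum)
  also have "\<dots> \<le> (\<Sum>x<n. 2 * \<delta> * real n)"
    by (intro sum_mono card_poor_le) (use n \<delta> in \<open>auto simp: slice_def\<close>)
  also have "\<dots> = 2 * \<delta> * (real n)\<^sup>2" by (simp add: power2_eq_square)
  finally show ?thesis .
qed

lemma sum_card_slice_not_fine_le:
  assumes inc: "inc2 f g h S" and fin: "finite S" and n: "f ` S \<subseteq> {..<n}" "g ` S \<subseteq> {..<n}"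
    and D: "\<And>i. i < D \<Longrightarrow> 2 ^ i \<le> n"
  shows "(\<Sum>i<D. card {a \<in> S. \<not> fine P (2 ^ i) (slice f g S (f a)) (g a)}) \<le> 4 * P * n\<^sup>2"
proof -
  have "(\<Sum>i<D. card {a \<in> S. \<not> fine P (2 ^ i) (slice f g S (f a)) (g a)}) =
      (\<Sum>i<D. \<Sum>x<n. card {y \<in> slice f g S x. \<not> fine P (2 ^ i) (slice f g S x) y})"
    by (intro sum.cong refl)
      (rule card_slice_pred[where Q = "\<lambda>B a. \<not> fine P (2 ^ _) B a", OF fin n(1) inc2_eq[OF inc]])
  also have "\<dots> = (\<Sum>x<n. \<Sum>i<D. card {y \<in> slice f g S x. \<not> fine P (2 ^ i) (slice f g S x) y})"
    by (rule sum.swap)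
  also have "\<dots> \<le> (\<Sum>x<n. 4 * P * n)"
    by (intro sum_mono sum_card_not_fine_le D) (use n in \<open>auto simp: slice_def\<close>)
  also have "\<dots> = 4 * P * n\<^sup>2" by (simp add: power2_eq_square)
  finally show ?thesis .
qed

text \<open>Discard the elements that are poor in one of their three slices. By
  \<open>no_fine_point\<close>, each remaining element fails to be fine in one of two ways at every
  one of \<open>D\<close> scales, whereas the total number of failures over all scales is at most
  \<open>8 * P * n^2\<close>, independently of \<open>D\<close>. A large \<open>D\<close> is
  contradictory.\<close>

lemma inc2_card_subquadratic:
  fixes c :: real
  assumes c: "c > 0"
  shows "\<exists>N. \<forall>n\<ge>N. \<forall>f g h S. finite S \<longrightarrow> inc2 f g h S \<longrightarrow> f ` S \<subseteq> {..<n} \<longrightarrow> g ` S \<subseteq> {..<n} \<longrightarrow>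
    h ` S \<subseteq> {..<n} \<longrightarrow> real (card S) < c * (real n)\<^sup>2"
proof -
  \<comment> \<open>The three sets of poor elements then have at most 6 \<delta> \<open>n^2\<close>
    = (3/8) \<open>c * n^2\<close> elements, leaving 5/8 of the assumed size.\<close>
  define \<delta> where "\<delta> = c / 16"
  have \<delta>: "\<delta> > 0" unfolding \<delta>_def using c by simp
  obtain q :: nat where q: "real q > 4 / \<delta> ^ 3" using reals_Archimedean2 by blast
  define P where "P = 2 * q + 2"
  \<comment> \<open>With this choice (5/8) \<open>c * D\<close> exceeds \<open>10 * P\<close>, hence
    the \<open>8 * P\<close> allowed by the failure count.\<close>
  obtain D :: nat where D: "real D > 16 * real P / c" using reals_Archimedean2 by blast
  have "real (card S) < c * (real n)\<^sup>2"
    if nN: "n \<ge> 2 ^ D" and fin: "finite S" and inc: "inc2 f g h S"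
      and n: "f ` S \<subseteq> {..<n}" "g ` S \<subseteq> {..<n}" "h ` S \<subseteq> {..<n}" for n f g h S
  proof (rule ccontr)
    assume "\<not> real (card S) < c * (real n)\<^sup>2"
    then have big: "c * (real n)\<^sup>2 \<le> real (card S)" by simp
    have n0: "n > 0" using nN by (metis gr0I le_zero_eq power_eq_0_iff zero_neq_numeral)
    have Dn: "2 ^ i \<le> n" if "i < D" for i
      using nN power_increasing[of i D "2::nat"] that by linarith
    \<comment> \<open>\<open>T\<close> is \<open>S\<close> without the elements of
      \<open>X2\<close>. Being a subset it is again 2-increasing, so the count of failures applies
      to its slices as well.\<close>
    define T where "T = {c \<in> S. rich \<delta> n (slice g h S (g c)) (h c)}"
    define X1 where "X1 = {a \<in> S. \<not> rich \<delta> n (slice f g S (f a)) (g a)}"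
    define X2 where "X2 = {a \<in> S. \<not> rich \<delta> n (slice g h S (g a)) (h a)}"
    define X3 where "X3 = {a \<in> S. \<not> rich \<delta> n (slice h f S (h a)) (f a)}"
    define U where "U = S - (X1 \<union> X2 \<union> X3)"
    define Y where "Y i = {a \<in> S. \<not> fine P (2 ^ i) (slice f g S (f a)) (g a)}" for i :: nat
    define Z where "Z i = {a \<in> T. \<not> fine P (2 ^ i) (slice h g T (h a)) (g a)}" for i :: nat
    have TS: "T \<subseteq> S" unfolding T_def by auto
    have finT: "finite T" using TS fin finite_subset by auto
    have nT: "h ` T \<subseteq> {..<n}" "g ` T \<subseteq> {..<n}"
      using n TS by (meson image_mono subset_trans)+
    note inc' = inc2_rotate[OF inc]
    note inc'' = inc2_rotate[OF inc']
    have 1: "real (card X1) \<le> 2 * \<delta> * (real n)\<^sup>2" unfolding X1_def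
      by (rule card_slice_poor_le[OF inc fin]) (use n \<delta> in auto)
    have 2: "real (card X2) \<le> 2 * \<delta> * (real n)\<^sup>2" unfolding X2_def
      by (rule card_slice_poor_le[OF inc' fin]) (use n \<delta> in auto)
    have 3: "real (card X3) \<le> 2 * \<delta> * (real n)\<^sup>2" unfolding X3_def
      by (rule card_slice_poor_le[OF inc'' fin]) (use n \<delta> in auto)
    have finX: "finite X1" "finite X2" "finite X3" "finite U"
      using fin unfolding X1_def X2_def X3_def U_def by auto
    have "card S \<le> card (U \<union> (X1 \<union> X2 \<union> X3))"
      by (intro card_mono) (use finX in \<open>auto simp: U_def\<close>)
    also have "\<dots> \<le> card U + (card X1 + card X2 + card X3)"
      by (meson add_le_mono card_Un_le le_trans order_refl)
    finally have "real (card S) \<le> real (card U) + (real (card X1) + real (card X2) + real (card X3))"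
      by linarith
    then have "c * (real n)\<^sup>2 \<le> real (card U) + 6 * \<delta> * (real n)\<^sup>2" using big 1 2 3 by linarith
    then have U: "5 / 8 * c * (real n)\<^sup>2 \<le> real (card U)" unfolding \<delta>_def by simp
    have sub: "U \<subseteq> Y i \<union> Z i" for i
    proof
      fix a assume a: "a \<in> U"
      show "a \<in> Y i \<union> Z i"
      proof (rule ccontr)
        assume "a \<notin> Y i \<union> Z i"
        moreover have "a \<in> S" "a \<in> T" using a unfolding U_def X2_def T_def by auto
        ultimately have "fine P (2 ^ i) (slice f g S (f a)) (g a)"
          "fine P (2 ^ i) (slice h g T (h a)) (g a)"
          unfolding Y_def Z_def by auto
        then show False
          using no_fine_point[OF inc fin n \<delta> q _ T_def \<open>a \<in> S\<close>, of "2 ^ i"] a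
          unfolding P_def U_def X1_def X3_def by auto
      qed
    qed
    have "card U \<le> card (Y i) + card (Z i)" for i
    proof -
      have "card U \<le> card (Y i \<union> Z i)"
        by (intro card_mono sub) (use fin finT in \<open>auto simp: Y_def Z_def\<close>)
      then show ?thesis using card_Un_le le_trans by blast
    qed
    then have "(\<Sum>i<D. card U) \<le> (\<Sum>i<D. card (Y i) + card (Z i))"
      by (intro sum_mono)
    also have "\<dots> = (\<Sum>i<D. card (Y i)) + (\<Sum>i<D. card (Z i))" by (rule sum.distrib)
    also have "\<dots> \<le> 4 * P * n\<^sup>2 + 4 * P * n\<^sup>2"
    proof (rule add_mono)
      show "(\<Sum>i<D. card (Y i)) \<le> 4 * P * n\<^sup>2" unfolding Y_def
        by (rule sum_card_slice_not_fine_le[OF inc fin n(1,2) Dn])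
      show "(\<Sum>i<D. card (Z i)) \<le> 4 * P * n\<^sup>2" unfolding Z_def
        by (rule sum_card_slice_not_fine_le[OF inc2_swap[OF inc2_subset[OF inc'' TS]] finT nT Dn])
    qed
    finally have "D * card U \<le> 8 * P * n\<^sup>2" by simp
    then have "real (D * card U) \<le> real (8 * P * n\<^sup>2)" by (simp only: of_nat_le_iff)
    then have "real D * real (card U) \<le> 8 * real P * (real n)\<^sup>2" by simp
    moreover have "real D * (5 / 8 * c * (real n)\<^sup>2) \<le> real D * real (card U)"
      by (intro mult_left_mono U) auto
    ultimately have "(real D * (5 / 8 * c)) * (real n)\<^sup>2 \<le> (8 * real P) * (real n)\<^sup>2"
      by (simp add: mult_ac)
    then have "real D * (5 / 8 * c) \<le> 8 * real P" using n0 by simp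
    moreover have "16 * real P < real D * c" using D c by (simp add: divide_less_eq)
    moreover have "real P > 0" unfolding P_def by simp
    ultimately show False by simp
  qed
  then show ?thesis by (intro exI[of _ "2 ^ D"] allI impI)
qed

section \<open>Coarsening to a grid\<close>

lemma card_filter_eq_sum:
  "finite A \<Longrightarrow> card {x \<in> A. P x} = (\<Sum>x\<in>A. if P x then 1 else 0)"
  unfolding card_eq_sum by (rule sum.inter_filter)

text \<open>The split is by rank: \<phi> is \<open>rk x * K div r\<close>. The ranks in one part
  span less than \<open>r / K\<close>, so the part has at most \<open>r / K + 1\<close> elements,
  which is at most \<open>2 * r / K\<close> because \<open>K\<close> \<le> \<open>r\<close>.\<close>

lemma monotone_split:
  fixes A :: "nat set"
  assumes fin: "finite A" and K: "K > 0" "K \<le> card A"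
  shows "\<exists>\<phi>. (\<forall>x\<in>A. \<phi> x < K) \<and> (\<forall>x\<in>A. \<forall>y\<in>A. x \<le> y \<longrightarrow> \<phi> x \<le> \<phi> y) \<and>
    (\<forall>i. K * card {x \<in> A. \<phi> x = i} \<le> 2 * card A)"
proof -
  define rk where "rk x = card {y \<in> A. y < x}" for x
  define r where "r = card A"
  define \<phi> where "\<phi> x = rk x * K div r" for x
  have r: "r > 0" using K unfolding r_def by simp
  have rk_less: "rk x < rk y" if "x \<in> A" "x < y" for x y
    unfolding rk_def using that fin by (intro psubset_card_mono) auto
  have rk_r: "rk x < r" if "x \<in> A" for x
    unfolding rk_def r_def using that fin by (intro psubset_card_mono) auto
  have rk_mono: "rk x \<le> rk y" if "x \<in> A" "x \<le> y" for x y
    using rk_less[OF that(1), of y] that by (cases "x = y") auto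
  have inj: "inj_on rk A"
  proof (rule inj_onI)
    fix x y assume "x \<in> A" "y \<in> A" "rk x = rk y"
    then show "x = y" using rk_less[of x y] rk_less[of y x] by (cases x y rule: linorder_cases) auto
  qed
  have "K * card {x \<in> A. \<phi> x = i} \<le> 2 * r" for i
  proof (cases "{x \<in> A. \<phi> x = i} = {}")
    case True
    show ?thesis unfolding True by simp
  next
    case False
    define R where "R = rk ` {x \<in> A. \<phi> x = i}"
    have finR: "finite R" and neR: "R \<noteq> {}" unfolding R_def using fin False by auto
    have cR: "card R = card {x \<in> A. \<phi> x = i}"
      unfolding R_def by (rule card_image) (rule inj_on_subset[OF inj], auto)
    have div: "k * K div r = i" if "k \<in> R" for k using that unfolding R_def \<phi>_def by auto
    have lo: "i * r \<le> Min R * K"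
      using div[OF Min_in[OF finR neR]] by (metis div_times_less_eq_dividend)
    have hi: "Max R * K < (i + 1) * r"
      using div[OF Max_in[OF finR neR]] r by (metis Suc_eq_plus1 dividend_less_div_times mult.commute mult_Suc_right add.commute)
    have "Min R \<le> Max R" using finR neR by simp
    have "card R \<le> card {Min R..Max R}"
      by (intro card_mono) (use finR in auto)
    then have "card R \<le> Max R - Min R + 1" using \<open>Min R \<le> Max R\<close> by simp
    then have "K * card R \<le> K * (Max R - Min R + 1)" by (rule mult_left_mono) simp
    also have "\<dots> = Max R * K - Min R * K + K" by (simp add: algebra_simps diff_mult_distrib2)
    also have "\<dots> \<le> r + K" using lo hi by (simp add: algebra_simps)
    also have "\<dots> \<le> 2 * r" using K unfolding r_def by simp
    finally show ?thesis using cR by simp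
  qed
  moreover have "\<phi> x < K" if "x \<in> A" for x
    unfolding \<phi>_def using rk_r[OF that] K r
    by (metis div_less_iff_less_mult mult.commute mult_less_cancel2)
  moreover have "\<phi> x \<le> \<phi> y" if "x \<in> A" "x \<le> y" for x y
    unfolding \<phi>_def using rk_mono[OF that] by (intro div_le_mono mult_right_mono) auto
  ultimately show ?thesis unfolding r_def by blast
qed

text \<open>Double counting of pairs of a cell and an \<open>f\<close>-value occurring in it: for a
  fixed value, the cells are determined by \<open>u\<close>, which takes fewer than
  \<open>m + 1\<close> values.\<close>

lemma sum_card_cells_le:
  fixes u :: "nat \<Rightarrow> nat" and f :: "nat \<Rightarrow> nat"
  assumes fin: "finite S" and u: "\<And>k. k \<in> S \<Longrightarrow> u k < m"
    and det: "\<And>k k'. k \<in> S \<Longrightarrow> k' \<in> S \<Longrightarrow> f k = f k' \<Longrightarrow> u k = u k' \<Longrightarrow> \<kappa> k = \<kappa> k'"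
  shows "(\<Sum>v\<in>\<kappa> ` S. card (f ` {k \<in> S. \<kappa> k = v})) \<le> m * card (f ` S)"
proof -
  have "(\<Sum>v\<in>\<kappa> ` S. card (f ` {k \<in> S. \<kappa> k = v})) =
      (\<Sum>v\<in>\<kappa> ` S. \<Sum>x\<in>f ` S. if x \<in> f ` {k \<in> S. \<kappa> k = v} then 1 else 0)"
  proof (rule sum.cong[OF refl])
    fix v
    have "f ` {k \<in> S. \<kappa> k = v} = {x \<in> f ` S. x \<in> f ` {k \<in> S. \<kappa> k = v}}" by auto
    then have "card (f ` {k \<in> S. \<kappa> k = v}) = card {x \<in> f ` S. x \<in> f ` {k \<in> S. \<kappa> k = v}}"
      by (rule arg_cong)
    also have "\<dots> = (\<Sum>x\<in>f ` S. if x \<in> f ` {k \<in> S. \<kappa> k = v} then 1 else 0)"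
      by (rule card_filter_eq_sum) (use fin in simp)
    finally show "card (f ` {k \<in> S. \<kappa> k = v}) = (\<Sum>x\<in>f ` S. if x \<in> f ` {k \<in> S. \<kappa> k = v} then 1 else 0)" .
  qed
  also have "\<dots> = (\<Sum>x\<in>f ` S. \<Sum>v\<in>\<kappa> ` S. if x \<in> f ` {k \<in> S. \<kappa> k = v} then 1 else 0)"
    by (rule sum.swap)
  also have "\<dots> \<le> (\<Sum>x\<in>f ` S. m)"
  proof (rule sum_mono)
    fix x
    define X where "X = {k \<in> S. f k = x}"
    have "(\<Sum>v\<in>\<kappa> ` S. if x \<in> f ` {k \<in> S. \<kappa> k = v} then 1 else 0) = card {v \<in> \<kappa> ` S. x \<in> f ` {k \<in> S. \<kappa> k = v}}"
      by (rule card_filter_eq_sum[symmetric]) (use fin in simp)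
    also have "\<dots> = card (\<kappa> ` X)"
    proof (rule arg_cong[where f = card], intro set_eqI iffI)
      fix v assume "v \<in> {v \<in> \<kappa> ` S. x \<in> f ` {k \<in> S. \<kappa> k = v}}"
      then obtain k where "k \<in> S" "\<kappa> k = v" "x = f k" by (elim CollectE conjE imageE)
      then show "v \<in> \<kappa> ` X" unfolding X_def by (intro image_eqI[of _ _ k]) simp_all
    next
      fix v assume "v \<in> \<kappa> ` X"
      then obtain k where "k \<in> S" "f k = x" "v = \<kappa> k" unfolding X_def by (elim imageE CollectE conjE)
      then show "v \<in> {v \<in> \<kappa> ` S. x \<in> f ` {k \<in> S. \<kappa> k = v}}" by (auto intro!: image_eqI[of _ _ k])
    qed
    also have "\<dots> \<le> card (u ` X)"
    proof -
      have "\<kappa> (SOME k'. k' \<in> X \<and> u k' = u k) = \<kappa> k" if k: "k \<in> X" for k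
      proof (rule det)
        have "(SOME k'. k' \<in> X \<and> u k' = u k) \<in> X \<and> u (SOME k'. k' \<in> X \<and> u k' = u k) = u k"
          by (rule someI[of _ k]) (use k in simp)
        then show "(SOME k'. k' \<in> X \<and> u k' = u k) \<in> S" "u (SOME k'. k' \<in> X \<and> u k' = u k) = u k"
          "f (SOME k'. k' \<in> X \<and> u k' = u k) = f k" "k \<in> S"
          using k unfolding X_def by blast+
      qed
      \<comment> \<open>On \<open>X\<close> the label \<kappa> factors through \<open>u\<close>;
        \<open>SOME\<close> picks a representative for each value of \<open>u\<close>.\<close>
      then have eq: "\<kappa> ` X = (\<lambda>y. \<kappa> (SOME k. k \<in> X \<and> u k = y)) ` u ` X"
        unfolding image_image by (intro image_cong refl) metis
      show ?thesis unfolding eq by (rule card_image_le) (use fin in \<open>simp add: X_def\<close>)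
    qed
    also have "\<dots> \<le> card {..<m}" by (intro card_mono) (use u in \<open>auto simp: X_def\<close>)
    finally show "(\<Sum>v\<in>\<kappa> ` S. if x \<in> f ` {k \<in> S. \<kappa> k = v} then 1 else 0) \<le> m" by simp
  qed
  finally show ?thesis by (simp add: mult.commute)
qed

text \<open>Averaging, separately for each key: a uniformly random element of \<open>Amb i\<close>
  lies in each \<open>A v\<close> with probability at least \<epsilon>, so some element hits at
  least the proportion \<epsilon> of the sets with key \<open>i\<close>.\<close>

lemma exists_hitting_selection:
  fixes \<epsilon> :: real
  assumes fin: "finite H" and finA: "\<And>i. finite (Amb i)"
    and sub: "\<And>v. v \<in> H \<Longrightarrow> A v \<subseteq> Amb (key v)" and ne: "\<And>v. v \<in> H \<Longrightarrow> A v \<noteq> {}"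
    and dens: "\<And>v. v \<in> H \<Longrightarrow> \<epsilon> * real (card (Amb (key v))) \<le> real (card (A v))"
  shows "\<exists>sel. \<epsilon> * real (card H) \<le> real (card {v \<in> H. sel (key v) \<in> A v})"
proof -
  define Hi where "Hi i = {v \<in> H. key v = i}" for i
  have finHi: "finite (Hi i)" for i unfolding Hi_def using fin by auto
  have "\<exists>x. \<epsilon> * real (card (Hi i)) \<le> real (card {v \<in> Hi i. x \<in> A v})" if i: "i \<in> key ` H" for i
  proof (rule ccontr)
    assume "\<not> ?thesis"
    then have lt: "real (card {v \<in> Hi i. x \<in> A v}) < \<epsilon> * real (card (Hi i))" for x by (simp add: not_le)
    have neA: "Amb i \<noteq> {}" using i sub ne by fastforce
    have "(\<Sum>v\<in>Hi i. card (A v)) = (\<Sum>v\<in>Hi i. \<Sum>x\<in>Amb i. if x \<in> A v then 1 else 0)"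
    proof (rule sum.cong[OF refl])
      fix v assume "v \<in> Hi i"
      then have "A v = {x \<in> Amb i. x \<in> A v}" using sub unfolding Hi_def by auto
      then have "card (A v) = card {x \<in> Amb i. x \<in> A v}" by (rule arg_cong)
      then show "card (A v) = (\<Sum>x\<in>Amb i. if x \<in> A v then 1 else 0)"
        unfolding card_filter_eq_sum[OF finA] .
    qed
    also have "\<dots> = (\<Sum>x\<in>Amb i. \<Sum>v\<in>Hi i. if x \<in> A v then 1 else 0)" by (rule sum.swap)
    also have "\<dots> = (\<Sum>x\<in>Amb i. card {v \<in> Hi i. x \<in> A v})"
      unfolding card_filter_eq_sum[OF finHi] ..
    finally have "real (\<Sum>v\<in>Hi i. card (A v)) = real (\<Sum>x\<in>Amb i. card {v \<in> Hi i. x \<in> A v})" by simp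
    then have "(\<Sum>v\<in>Hi i. real (card (A v))) = (\<Sum>x\<in>Amb i. real (card {v \<in> Hi i. x \<in> A v}))" by simp
    also have "\<dots> < (\<Sum>x\<in>Amb i. \<epsilon> * real (card (Hi i)))"
      by (intro sum_strict_mono finA neA lt)
    finally have 1: "(\<Sum>v\<in>Hi i. real (card (A v))) < real (card (Amb i)) * (\<epsilon> * real (card (Hi i)))" by simp
    have "(\<Sum>v\<in>Hi i. \<epsilon> * real (card (Amb i))) \<le> (\<Sum>v\<in>Hi i. real (card (A v)))"
      by (intro sum_mono) (use dens in \<open>auto simp: Hi_def\<close>)
    then show False using 1 by (simp add: mult_ac)
  qed
  then obtain sel where sel: "\<And>i. i \<in> key ` H \<Longrightarrow> \<epsilon> * real (card (Hi i)) \<le> real (card {v \<in> Hi i. sel i \<in> A v})"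
    by metis
  have dec: "card H' = (\<Sum>i\<in>key ` H. card {v \<in> H'. key v = i})" if "H' \<subseteq> H" for H'
  proof -
    have "finite H'" using that fin finite_subset by blast
    have "H' = (\<Union>i\<in>key ` H. {v \<in> H'. key v = i})" using that by auto
    also have "card \<dots> = (\<Sum>i\<in>key ` H. card {v \<in> H'. key v = i})"
      by (rule card_UN_disjoint) (use fin \<open>finite H'\<close> in auto)
    finally show ?thesis .
  qed
  have "\<epsilon> * real (card H) = (\<Sum>i\<in>key ` H. \<epsilon> * real (card (Hi i)))"
    using dec[of H] by (simp add: Hi_def sum_distrib_left)
  also have "\<dots> \<le> (\<Sum>i\<in>key ` H. real (card {v \<in> Hi i. sel i \<in> A v}))"
    by (intro sum_mono sel)
  also have "\<dots> = real (\<Sum>i\<in>key ` H. card {v \<in> {v \<in> H. sel (key v) \<in> A v}. key v = i})"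
    unfolding of_nat_sum Hi_def by (intro sum.cong refl arg_cong[where f = "\<lambda>X. real (card X)"]) auto
  also have "\<dots> = real (card {v \<in> H. sel (key v) \<in> A v})"
    by (subst (2) dec) auto
  finally show ?thesis by blast
qed

text \<open>One representative per fibre. It serves to thin out cells until no two of them share a
  given pair of coordinates.\<close>

lemma exists_inj_subset:
  assumes fin: "finite H" and fib: "\<And>y. card {v \<in> H. p v = y} \<le> Q"
  shows "\<exists>M\<subseteq>H. inj_on p M \<and> card H \<le> Q * card M"
proof -
  obtain M where M: "M \<subseteq> H" "inj_on p M" "p ` H = p ` M"
    using subset_image_inj[of "p ` H" p H] by auto
  have "H = (\<Union>y\<in>p ` H. {v \<in> H. p v = y})" by auto
  then have "card H \<le> (\<Sum>y\<in>p ` H. card {v \<in> H. p v = y})"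
    using card_UN_le[of "p ` H" "\<lambda>y. {v \<in> H. p v = y}"] fin by simp
  also have "\<dots> \<le> (\<Sum>y\<in>p ` H. Q)" by (intro sum_mono fib)
  also have "\<dots> = Q * card M" using M by (simp add: card_image)
  finally show ?thesis using M by blast
qed

text \<open>Elements \<open>e\<close> and \<open>e'\<close> with the same \<open>f\<close>-value are
  strictly ordered in both other coordinates, and so are their cells once these differ. As
  \<open>k\<close> and \<open>k'\<close> lie in the same coarse intervals, they inherit this order;
  the reversed direction would give \<open>k' < k\<close> by \<open>inc2_before\<close>.\<close>

lemma inc2_coarse_same:
  assumes inc: "inc2 f g h S"
    and G: "\<And>i j. i \<in> S \<Longrightarrow> j \<in> S \<Longrightarrow> g i \<le> g j \<Longrightarrow> G i \<le> (G j :: nat)"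
    and H: "\<And>i j. i \<in> S \<Longrightarrow> j \<in> S \<Longrightarrow> h i \<le> h j \<Longrightarrow> H i \<le> (H j :: nat)"
    and S: "e \<in> S" "e' \<in> S" "k \<in> S" "k' \<in> S"
    and e: "f e = f e'" "G e = G k" "H e = H k" "G e' = G k'" "H e' = H k'"
    and k: "k < k'" "G k \<noteq> G k'" "H k \<noteq> H k'"
  shows "G k < G k' \<and> H k < H k'"
proof (cases "e < e'")
  case True
  then have "g e < g e'" "h e < h e'" using inc2_same[OF inc] S e by auto
  then show ?thesis using G[OF S(1,2)] H[OF S(1,2)] e k by auto
next
  case False
  moreover have "e \<noteq> e'" using e k by auto
  ultimately have "e' < e" by auto
  then have "g e' < g e" "h e' < h e" using inc2_same[OF inc] S e by auto
  then have "G k' < G k" "H k' < H k" using G[OF S(2,1)] H[OF S(2,1)] e k by auto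
  then have "g k' < g k" "h k' < h k" using G[OF S(3,4)] H[OF S(3,4)] by (meson not_less leD)+
  then have "k' < k" using inc2_before[OF inc2_rotate[OF inc] S(4,3)] by auto
  then show ?thesis using k by auto
qed

section \<open>Real inequalities for the induction\<close>

text \<open>Bound \<open>a\<close> by \<epsilon> and \<open>b * c\<close> by the square of the sum.
  Thus cells with one small side fraction contribute little, since side fractions have a controlled
  total.\<close>

lemma sqrt_prod_le:
  fixes a b c \<epsilon> :: real
  assumes "0 \<le> a" "0 \<le> b" "0 \<le> c" "a < \<epsilon>"
  shows "sqrt (a * b * c) \<le> sqrt \<epsilon> * (a + b + c)"
proof -
  have \<epsilon>: "\<epsilon> > 0" using assms by linarith
  have bc: "b * c \<le> (a + b + c)\<^sup>2"
    using assms by (simp add: power2_eq_square algebra_simps add_nonneg_nonneg)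
  have "a * b * c \<le> \<epsilon> * (a + b + c)\<^sup>2"
    using mult_mono[OF less_imp_le[OF assms(4)] bc] assms \<epsilon> by (simp add: mult.assoc)
  then have "sqrt (a * b * c) \<le> sqrt (\<epsilon> * (a + b + c)\<^sup>2)" by (rule real_sqrt_le_mono)
  also have "\<dots> = sqrt \<epsilon> * (a + b + c)" using assms by (simp add: real_sqrt_mult)
  finally show ?thesis .
qed

text \<open>Converts the inductive bound for a part of the sequence into a bound relative to the
  whole: \<open>p\<close> is the product of the sides of the part, \<open>R\<close> that of the
  whole, and \<open>x\<close> the product of the sides measured in units of \<open>2 / K\<close>.
  The hypothesis \<open>pw\<close> turns the volume factor into \<open>16 / K^2\<close>.\<close>

lemma powr_scaled_le:
  fixes p x R C \<theta> :: real
  assumes "0 \<le> p" "0 \<le> x" "0 \<le> R" "0 \<le> C" "0 \<le> \<theta>" "K > 0" "real K ^ 3 * p \<le> 8 * x * R"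
    and pw: "(8 / real K ^ 3) powr \<theta> \<le> 16 / (real K)\<^sup>2"
  shows "C * p powr \<theta> \<le> C * R powr \<theta> * 16 / (real K)\<^sup>2 * x powr \<theta>"
proof -
  have "p \<le> (8 / real K ^ 3) * x * R" using assms(6,7) by (simp add: field_simps)
  then have "p powr \<theta> \<le> ((8 / real K ^ 3) * x * R) powr \<theta>" by (rule powr_mono2[OF assms(5,1)])
  also have "\<dots> = (8 / real K ^ 3) powr \<theta> * x powr \<theta> * R powr \<theta>" 
    using assms(2,3) by (simp only: powr_mult)
  also have "\<dots> \<le> 16 / (real K)\<^sup>2 * x powr \<theta> * R powr \<theta>" by (intro mult_right_mono pw) auto
  finally have "C * p powr \<theta> \<le> C * (16 / (real K)\<^sup>2 * x powr \<theta> * R powr \<theta>)" using assms(4) by (intro mult_left_mono)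
  then show ?thesis by (simp add: mult_ac)
qed

text \<open>For \<open>q > 1\<close> replace \<theta> by 2/3 and cancel, which leaves the cube root
  of \<open>q\<close> bounded by \<open>B\<close>.\<close>

lemma le_cube_if_le_powr:
  fixes q B \<theta> :: real
  assumes "q \<ge> 0" "B \<ge> 1" "\<theta> \<le> 2 / 3" "q \<le> B * q powr \<theta>"
  shows "q \<le> B ^ 3"
proof (cases "q \<le> 1")
  case True
  then show ?thesis using one_le_power[OF assms(2), of 3] by linarith
next
  case False
  then have q: "q > 1" by simp
  have "q powr \<theta> \<le> q powr (2/3)" using q assms by (intro powr_mono) auto
  then have "B * q powr \<theta> \<le> B * q powr (2/3)" using assms by (intro mult_left_mono) auto
  then have "q \<le> B * q powr (2/3)" using assms by linarith
  moreover have "q = q powr (1/3) * q powr (2/3)" using q by (simp flip: powr_add)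
  ultimately have "q powr (1/3) * q powr (2/3) \<le> B * q powr (2/3)" by simp
  then have "q powr (1/3) \<le> B" using q by simp
  then have "(q powr (1/3)) ^ 3 \<le> B ^ 3" by (intro power_mono) auto
  moreover have "(q powr (1/3)) ^ 3 = q" using q by (simp add: powr_power)
  ultimately show ?thesis by simp
qed

section \<open>Coarse coordinates and their cells\<close>

text \<open>The coarse coordinate is a function on the same indices; monotonicity applied in both
  directions makes it depend on the value of \<open>f\<close> alone. The factor 2 comes from
  rounding in \<open>monotone_split\<close>.\<close>

definition coarsening :: "nat \<Rightarrow> (nat \<Rightarrow> nat) \<Rightarrow> (nat \<Rightarrow> nat) \<Rightarrow> nat set \<Rightarrow> bool" where
  "coarsening K f F S \<longleftrightarrow> (\<forall>k\<in>S. F k < K) \<and> (\<forall>i\<in>S. \<forall>j\<in>S. f i \<le> f j \<longrightarrow> F i \<le> F j) \<and>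
     (\<forall>i. K * card (f ` {k \<in> S. F k = i}) \<le> 2 * card (f ` S))"

lemma exists_coarsening:
  assumes "finite S" "K > 0" "K \<le> card (f ` S)"
  shows "\<exists>F. coarsening K f F S"
proof -
  obtain \<phi> where \<phi>: "\<forall>x\<in>f ` S. \<phi> x < K" "\<forall>x\<in>f ` S. \<forall>y\<in>f ` S. x \<le> y \<longrightarrow> \<phi> x \<le> \<phi> y"
      "\<And>i. K * card {x \<in> f ` S. \<phi> x = i} \<le> 2 * card (f ` S)"
    using monotone_split[of "f ` S" K] assms by auto
  have "{x \<in> f ` S. \<phi> x = i} = f ` {k \<in> S. \<phi> (f k) = i}" for i by auto
  then have "coarsening K f (\<lambda>k. \<phi> (f k)) S"
    using \<phi> unfolding coarsening_def by auto
  then show ?thesis by blast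
qed

lemma coarseningD:
  assumes "coarsening K f F S"
  shows "k \<in> S \<Longrightarrow> F k < K" "i \<in> S \<Longrightarrow> j \<in> S \<Longrightarrow> f i \<le> f j \<Longrightarrow> F i \<le> F j"
    "i \<in> S \<Longrightarrow> j \<in> S \<Longrightarrow> f i = f j \<Longrightarrow> F i = F j"
proof -
  show "k \<in> S \<Longrightarrow> F k < K" using assms unfolding coarsening_def by blast
  show *: "i \<in> S \<Longrightarrow> j \<in> S \<Longrightarrow> f i \<le> f j \<Longrightarrow> F i \<le> F j" for i j
    using assms unfolding coarsening_def by blast
  show "i \<in> S \<Longrightarrow> j \<in> S \<Longrightarrow> f i = f j \<Longrightarrow> F i = F j"
    using *[of i j] *[of j i] by simp
qed

lemma coarsening_card_le:
  assumes "coarsening K f F S" "finite S" "T \<subseteq> {k \<in> S. F k = i}"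
  shows "K * card (f ` T) \<le> 2 * card (f ` S)"
proof -
  have "card (f ` T) \<le> card (f ` {k \<in> S. F k = i})"
    using assms by (intro card_mono image_mono) auto
  then have "K * card (f ` T) \<le> K * card (f ` {k \<in> S. F k = i})" by simp
  then show ?thesis using assms(1) unfolding coarsening_def by (meson le_trans)
qed

text \<open>Each slice is a chain and therefore meets fewer than \<open>2 K\<close> cells.\<close>

lemma sum_cell_fraction_le:
  assumes inc: "inc2 f g h S" and fin: "finite S"
    and F: "coarsening K f F S" and G: "coarsening K g G S" and H: "coarsening K h H S"
    and det: "\<And>k k'. F k = F k' \<Longrightarrow> G k = G k' \<Longrightarrow> H k = H k' \<Longrightarrow> \<kappa> k = \<kappa> k'"
  shows "(\<Sum>v\<in>\<kappa> ` S. real K * real (card (f ` {k \<in> S. \<kappa> k = v})) / (2 * real (card (f ` S)))) \<le> (real K)\<^sup>2"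
proof -
  define r where "r = card (f ` S)"
  have "(\<Sum>v\<in>\<kappa> ` S. card (f ` {k \<in> S. \<kappa> k = v})) \<le> (2 * K) * r"
    unfolding r_def
  proof (rule sum_card_cells_le[OF fin, of "\<lambda>k. G k + H k"])
    show "G k + H k < 2 * K" if "k \<in> S" for k
      using coarseningD(1)[OF G that] coarseningD(1)[OF H that] by simp
    have le: "\<kappa> k = \<kappa> k'" if "k \<in> S" "k' \<in> S" "f k = f k'" "G k + H k = G k' + H k'" "k < k'" for k k'
    proof (rule det)
      have "G k \<le> G k'" "H k \<le> H k'"
        using inc2_same[OF inc that(1,2,3,5)] coarseningD(2)[OF G that(1,2)] coarseningD(2)[OF H that(1,2)] by auto
      then show "G k = G k'" "H k = H k'" using that by auto
      show "F k = F k'" by (rule coarseningD(3)[OF F that(1,2,3)])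
    qed
    show "\<kappa> k = \<kappa> k'" if "k \<in> S" "k' \<in> S" "f k = f k'" "G k + H k = G k' + H k'" for k k'
      using le[OF that] le[OF that(2,1) that(3,4)[symmetric]] by (metis linorder_less_linear)
  qed
  then have "real (\<Sum>v\<in>\<kappa> ` S. card (f ` {k \<in> S. \<kappa> k = v})) \<le> real ((2 * K) * r)" by (simp only: of_nat_le_iff)
  then have le: "(\<Sum>v\<in>\<kappa> ` S. real (card (f ` {k \<in> S. \<kappa> k = v}))) \<le> 2 * real K * real r" by simp
  have "(\<Sum>v\<in>\<kappa> ` S. real K * real (card (f ` {k \<in> S. \<kappa> k = v})) / (2 * real r)) =
      real K / (2 * real r) * (\<Sum>v\<in>\<kappa> ` S. real (card (f ` {k \<in> S. \<kappa> k = v})))"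
    by (simp add: sum_distrib_left)
  also have "\<dots> \<le> real K / (2 * real r) * (2 * real K * real r)"
    by (rule mult_left_mono[OF le]) simp
  also have "\<dots> \<le> (real K)\<^sup>2" by (cases "r = 0") (simp_all add: power2_eq_square)
  finally show ?thesis unfolding r_def .
qed

text \<open>Let \<open>q\<close> be the number of heavy cells over one pair \<open>(i, j)\<close>.
  Their union has sides at most \<open>2 * r / K\<close>, \<open>2 * s / K\<close> and
  \<open>2 * q * t / K\<close>, so by induction it has at most 16 \<Phi> / \<open>K^2\<close> times
  \<open>q powr\<close> \<theta> elements. Heaviness forces at least \<epsilon> \<Phi>
  \<open>q / (4 * K^2)\<close>. Since \<theta> is below 1, this bounds \<open>q\<close>.\<close>

lemma card_heavy_pillar_le:
  fixes \<theta> C \<epsilon> :: real and f g h :: "nat \<Rightarrow> nat"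
  assumes fin: "finite S" and K: "K \<ge> 3" and ne: "S \<noteq> {}"
    and F: "coarsening K f F S" and G: "coarsening K g G S" and H: "coarsening K h H S"
    and det: "\<And>k k'. k \<in> S \<Longrightarrow> k' \<in> S \<Longrightarrow> \<kappa> k = \<kappa> k' \<Longrightarrow> H k = H k'"
    and \<theta>: "0 \<le> \<theta>" "\<theta> \<le> 2 / 3" and C: "C > 0" and \<epsilon>: "0 < \<epsilon>" "\<epsilon> \<le> 1"
    and pw: "(8 / real K ^ 3) powr \<theta> \<le> 16 / (real K)\<^sup>2"
    and IH: "\<And>T. T \<subset> S \<Longrightarrow> real (card T) \<le> C * (real (card (f ` T)) * real (card (g ` T)) * real (card (h ` T))) powr \<theta>"
    and \<Phi>: "\<Phi> = C * (real (card (f ` S)) * real (card (g ` S)) * real (card (h ` S))) powr \<theta>"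
    and W: "finite W" "\<And>v. v \<in> W \<Longrightarrow> \<epsilon> * \<Phi> / (4 * (real K)\<^sup>2) \<le> real (card {k \<in> S. \<kappa> k = v})"
      "\<And>k. k \<in> S \<Longrightarrow> \<kappa> k \<in> W \<Longrightarrow> F k = i \<and> G k = j"
  shows "real (card W) \<le> (64 / \<epsilon>) ^ 3"
proof -
  define r where "r = card (f ` S)"
  define s where "s = card (g ` S)"
  define t where "t = card (h ` S)"
  define R where "R = real r * real s * real t"
  have pos: "r > 0" "s > 0" "t > 0" using fin ne unfolding r_def s_def t_def by auto
  have R: "R > 0" unfolding R_def using pos by simp
  have \<Phi>R: "\<Phi> = C * R powr \<theta>" unfolding \<Phi> R_def r_def s_def t_def ..
  have \<Phi>0: "\<Phi> > 0" unfolding \<Phi>R using C R by simp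
  have K0: "K > 0" using K by simp
  define T where "T = {k \<in> S. \<kappa> k \<in> W}"
  define q where "q = card W"
  define P where "P = real (card (f ` T)) * real (card (g ` T)) * real (card (h ` T))"
  have TS: "T \<subseteq> S" unfolding T_def by auto
  have TF: "K * card (f ` T) \<le> 2 * r" unfolding r_def
    by (rule coarsening_card_le[OF F fin, of _ i]) (use W(3) in \<open>auto simp: T_def\<close>)
  have TG: "K * card (g ` T) \<le> 2 * s" unfolding s_def
    by (rule coarsening_card_le[OF G fin, of _ j]) (use W(3) in \<open>auto simp: T_def\<close>)
  have cellH: "K * card (h ` {k \<in> S. \<kappa> k = v}) \<le> 2 * t" for v
  proof (cases "{k \<in> S. \<kappa> k = v} = {}")
    case False
    then obtain k where k: "k \<in> S" "\<kappa> k = v" by auto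
    have "H k' = H k" if "k' \<in> S" "\<kappa> k' = v" for k'
      using det[OF that(1) k(1)] that(2) k(2) by simp
    then have "{k \<in> S. \<kappa> k = v} \<subseteq> {k' \<in> S. H k' = H k}" by blast
    then show ?thesis unfolding t_def by (rule coarsening_card_le[OF H fin])
  next
    case True
    show ?thesis unfolding True by simp
  qed
  have "h ` T = (\<Union>v\<in>W. h ` {k \<in> S. \<kappa> k = v})" unfolding T_def by auto
  then have "K * card (h ` T) \<le> K * (\<Sum>v\<in>W. card (h ` {k \<in> S. \<kappa> k = v}))"
    using card_UN_le[OF W(1), of "\<lambda>v. h ` {k \<in> S. \<kappa> k = v}"] by simp
  also have "\<dots> = (\<Sum>v\<in>W. K * card (h ` {k \<in> S. \<kappa> k = v}))" by (rule sum_distrib_left)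
  also have "\<dots> \<le> (\<Sum>v\<in>W. 2 * t)" by (intro sum_mono cellH)
  finally have TH: "K * card (h ` T) \<le> q * (2 * t)" unfolding q_def by simp
  \<comment> \<open>Properness is what allows the induction hypothesis; it holds because
    \<open>K\<close> \<ge> 3 exceeds the factor 2 in the definition of
    \<open>coarsening\<close>.\<close>
  have "T \<noteq> S"
  proof
    assume "T = S"
    then have "K * r \<le> 2 * r" using TF unfolding r_def by simp
    then show False using pos K by simp
  qed
  then have "T \<subset> S" using TS by auto
  then have 1: "real (card T) \<le> C * P powr \<theta>" unfolding P_def by (rule IH)
  have "(K * card (f ` T)) * (K * card (g ` T)) * (K * card (h ` T)) \<le> (2 * r) * (2 * s) * (q * (2 * t))"
    by (intro mult_le_mono TF TG TH)
  then have "real ((K * card (f ` T)) * (K * card (g ` T)) * (K * card (h ` T))) \<le> real ((2 * r) * (2 * s) * (q * (2 * t)))"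
    by (simp only: of_nat_le_iff)
  then have "real K ^ 3 * P \<le> 8 * real q * R" unfolding P_def R_def by (simp add: power3_eq_cube mult_ac)
  then have "C * P powr \<theta> \<le> C * R powr \<theta> * 16 / (real K)\<^sup>2 * real q powr \<theta>"
    by (intro powr_scaled_le) (use R C \<theta> K0 pw in \<open>auto simp: P_def\<close>)
  then have 2: "real (card T) \<le> \<Phi> * 16 / (real K)\<^sup>2 * real q powr \<theta>" using 1 unfolding \<Phi>R by linarith
  have "real q * (\<epsilon> * \<Phi> / (4 * (real K)\<^sup>2)) = (\<Sum>v\<in>W. \<epsilon> * \<Phi> / (4 * (real K)\<^sup>2))" unfolding q_def by simp
  also have "\<dots> \<le> (\<Sum>v\<in>W. real (card {k \<in> S. \<kappa> k = v}))" by (intro sum_mono W(2))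
  also have "\<dots> = real (card (\<Union>v\<in>W. {k \<in> S. \<kappa> k = v}))"
    by (subst card_UN_disjoint) (use W(1) fin in auto)
  also have "(\<Union>v\<in>W. {k \<in> S. \<kappa> k = v}) = T" unfolding T_def by auto
  also note 2
  finally have "(real q * \<epsilon> / 4) * (\<Phi> / (real K)\<^sup>2) \<le> (16 * real q powr \<theta>) * (\<Phi> / (real K)\<^sup>2)"
    by (simp add: mult_ac)
  moreover have "\<Phi> / (real K)\<^sup>2 > 0" using \<Phi>0 K0 by simp
  ultimately have "real q * \<epsilon> / 4 \<le> 16 * real q powr \<theta>" by (rule mult_right_le_imp_le)
  then have "real q \<le> 64 / \<epsilon> * real q powr \<theta>" using \<epsilon> by (simp add: field_simps)
  then show ?thesis unfolding q_def using \<theta> \<epsilon> by (intro le_cube_if_le_powr) auto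
qed

text \<open>
  Cells met by one common slice form a chain, so choosing a single slice inside each interval, at the
  cost of a factor \<open>\<epsilon>\<close> per coordinate, removes all order conflicts between cells sharing one coordinate.
\<close>

lemma exists_coarse_selection:
  fixes \<epsilon> :: real
  assumes inc: "inc2 f g h S" and fin: "finite S"
    and F: "coarsening K f F S" and G: "coarsening K g G S" and H: "coarsening K h H S"
    and \<kappa>: "\<kappa> = (\<lambda>k. (F k, G k, H k))" and Hs: "Hs \<subseteq> \<kappa> ` S" and \<epsilon>: "\<epsilon> \<ge> 0"
    and df: "\<And>v. v \<in> Hs \<Longrightarrow> \<epsilon> * real (card (f ` {k \<in> S. F k = fst v})) \<le> real (card (f ` {k \<in> S. \<kappa> k = v}))"
    and dg: "\<And>v. v \<in> Hs \<Longrightarrow> \<epsilon> * real (card (g ` {k \<in> S. G k = fst (snd v)})) \<le> real (card (g ` {k \<in> S. \<kappa> k = v}))"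
    and dh: "\<And>v. v \<in> Hs \<Longrightarrow> \<epsilon> * real (card (h ` {k \<in> S. H k = snd (snd v)})) \<le> real (card (h ` {k \<in> S. \<kappa> k = v}))"
    and fib: "\<And>y. card {v \<in> Hs. (fst v, fst (snd v)) = y} \<le> Q"
      "\<And>y. card {v \<in> Hs. (fst (snd v), snd (snd v)) = y} \<le> Q"
      "\<And>y. card {v \<in> Hs. (snd (snd v), fst v) = y} \<le> Q"
  shows "\<exists>M\<subseteq>S. inc2 F G H M \<and> \<epsilon> ^ 3 * real (card Hs) \<le> real Q ^ 3 * real (card M)"
proof -
  define cell where "cell v = {k \<in> S. \<kappa> k = v}" for v
  have cellne: "cell v \<noteq> {}" if "v \<in> Hs" for v using that Hs unfolding cell_def by auto
  have finH: "finite Hs" using Hs fin finite_subset by blast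
  \<comment> \<open>\<open>sx\<close> picks one \<open>f\<close>-value in each coarse interval, and
    only cells containing the value picked for their interval survive; \<open>sy\<close> and
    \<open>sz\<close> do the same for the other coordinates.\<close>
  obtain sx where sx: "\<epsilon> * real (card Hs) \<le> real (card {v \<in> Hs. sx (fst v) \<in> f ` cell v})"
  proof -
    have "\<exists>sel. \<epsilon> * real (card Hs) \<le> real (card {v \<in> Hs. sel (fst v) \<in> f ` cell v})"
    proof (rule exists_hitting_selection[where key = fst and Amb = "\<lambda>i. f ` {k \<in> S. F k = i}"])
      fix v assume "v \<in> Hs"
      then have v: "v \<in> Hs" .
      show "f ` cell v \<subseteq> f ` {k \<in> S. F k = fst v}" unfolding cell_def \<kappa> by auto
      show "f ` cell v \<noteq> {}" using cellne[OF v] by simp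
      show "\<epsilon> * real (card (f ` {k \<in> S. F k = fst v})) \<le> real (card (f ` cell v))"
        unfolding cell_def by (rule df[OF v])
    qed (use finH fin in auto)
    then show ?thesis using that by blast
  qed
  define H1 where "H1 = {v \<in> Hs. sx (fst v) \<in> f ` cell v}"
  have H1: "H1 \<subseteq> Hs" "finite H1" unfolding H1_def using finH by auto
  obtain sy where sy: "\<epsilon> * real (card H1) \<le> real (card {v \<in> H1. sy (fst (snd v)) \<in> g ` cell v})"
  proof -
    have "\<exists>sel. \<epsilon> * real (card H1) \<le> real (card {v \<in> H1. sel (fst (snd v)) \<in> g ` cell v})"
    proof (rule exists_hitting_selection[where key = "\<lambda>v. fst (snd v)" and Amb = "\<lambda>i. g ` {k \<in> S. G k = i}"])
      fix v assume "v \<in> H1"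
      then have v: "v \<in> Hs" using H1 by blast
      show "g ` cell v \<subseteq> g ` {k \<in> S. G k = fst (snd v)}" unfolding cell_def \<kappa> by auto
      show "g ` cell v \<noteq> {}" using cellne[OF v] by simp
      show "\<epsilon> * real (card (g ` {k \<in> S. G k = fst (snd v)})) \<le> real (card (g ` cell v))"
        unfolding cell_def by (rule dg[OF v])
    qed (use H1 fin in auto)
    then show ?thesis using that by blast
  qed
  define H2 where "H2 = {v \<in> H1. sy (fst (snd v)) \<in> g ` cell v}"
  have H2: "H2 \<subseteq> Hs" "finite H2" unfolding H2_def using H1 by auto
  obtain sz where sz: "\<epsilon> * real (card H2) \<le> real (card {v \<in> H2. sz (snd (snd v)) \<in> h ` cell v})"
  proof -
    have "\<exists>sel. \<epsilon> * real (card H2) \<le> real (card {v \<in> H2. sel (snd (snd v)) \<in> h ` cell v})"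
    proof (rule exists_hitting_selection[where key = "\<lambda>v. snd (snd v)" and Amb = "\<lambda>i. h ` {k \<in> S. H k = i}"])
      fix v assume "v \<in> H2"
      then have v: "v \<in> Hs" using H2 by blast
      show "h ` cell v \<subseteq> h ` {k \<in> S. H k = snd (snd v)}" unfolding cell_def \<kappa> by auto
      show "h ` cell v \<noteq> {}" using cellne[OF v] by simp
      show "\<epsilon> * real (card (h ` {k \<in> S. H k = snd (snd v)})) \<le> real (card (h ` cell v))"
        unfolding cell_def by (rule dh[OF v])
    qed (use H2 fin in auto)
    then show ?thesis using that by blast
  qed
  define H3 where "H3 = {v \<in> H2. sz (snd (snd v)) \<in> h ` cell v}"
  have H3: "H3 \<subseteq> Hs" "finite H3" unfolding H3_def using H2 by auto
  have "\<epsilon> * (\<epsilon> * real (card Hs)) \<le> \<epsilon> * real (card H1)" using sx \<epsilon> unfolding H1_def by (intro mult_left_mono) auto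
  also have "\<dots> \<le> real (card H2)" using sy unfolding H2_def .
  finally have "\<epsilon> * (\<epsilon> * (\<epsilon> * real (card Hs))) \<le> \<epsilon> * real (card H2)" using \<epsilon> by (intro mult_left_mono) auto
  also have "\<dots> \<le> real (card H3)" using sz unfolding H3_def .
  finally have 1: "\<epsilon> ^ 3 * real (card Hs) \<le> real (card H3)" by (simp add: power3_eq_cube mult_ac)
  have sub: "card {v \<in> M. p v = y} \<le> card {v \<in> Hs. p v = y}" if "M \<subseteq> Hs" for M and p :: "nat \<times> nat \<times> nat \<Rightarrow> nat \<times> nat" and y
    using that finH by (intro card_mono) auto
  \<comment> \<open>Three thinnings, each costing a factor \<open>Q\<close>, leave cells of which
    any two share at most one coarse coordinate.\<close>
  obtain M1 where M1: "M1 \<subseteq> H3" "inj_on (\<lambda>v. (fst v, fst (snd v))) M1" "card H3 \<le> Q * card M1"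
    using exists_inj_subset[OF H3(2), of "\<lambda>v. (fst v, fst (snd v))" Q] sub[OF H3(1)] fib(1) by (meson le_trans)
  have M1': "finite M1" "M1 \<subseteq> Hs" using M1 H3 finite_subset by auto
  obtain M2 where M2: "M2 \<subseteq> M1" "inj_on (\<lambda>v. (fst (snd v), snd (snd v))) M2" "card M1 \<le> Q * card M2"
    using exists_inj_subset[OF M1'(1), of "\<lambda>v. (fst (snd v), snd (snd v))" Q] sub[OF M1'(2)] fib(2) by (meson le_trans)
  have M2': "finite M2" "M2 \<subseteq> Hs" using M2 M1' finite_subset by auto
  obtain M where M: "M \<subseteq> M2" "inj_on (\<lambda>v. (snd (snd v), fst v)) M" "card M2 \<le> Q * card M"
    using exists_inj_subset[OF M2'(1), of "\<lambda>v. (snd (snd v), fst v)" Q] sub[OF M2'(2)] fib(3) by (meson le_trans)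
  have MH: "M \<subseteq> H3" using M M2 M1 by auto
  have "card H3 \<le> Q * (Q * (Q * card M))"
    using M1(3) M2(3) M(3) by (meson le_trans mult_le_mono2)
  then have "real (card H3) \<le> real (Q * (Q * (Q * card M)))" by (simp only: of_nat_le_iff)
  then have 2: "\<epsilon> ^ 3 * real (card Hs) \<le> real Q ^ 3 * real (card M)" using 1 by (simp add: power3_eq_cube mult_ac)
  have inj1: "v = v'" if "v \<in> M" "v' \<in> M" "fst v = fst v'" "fst (snd v) = fst (snd v')" for v v'
    using inj_onD[OF M1(2), of v v'] that M M2 by auto
  have inj2: "v = v'" if "v \<in> M" "v' \<in> M" "fst (snd v) = fst (snd v')" "snd (snd v) = snd (snd v')" for v v'
    using inj_onD[OF M2(2), of v v'] that M by auto
  have inj3: "v = v'" if "v \<in> M" "v' \<in> M" "snd (snd v) = snd (snd v')" "fst v = fst v'" for v v'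
    using inj_onD[OF M(2), of v v'] that by auto
  have "\<forall>v\<in>M. \<exists>k. k \<in> cell v" using MH H3 cellne by blast
  \<comment> \<open>One index per cell; the order of these indices orders the coarse
    sequence.\<close>
  then obtain \<rho> where \<rho>: "\<And>v. v \<in> M \<Longrightarrow> \<rho> v \<in> cell v" by metis
  have \<rho>S: "\<rho> v \<in> S" "\<kappa> (\<rho> v) = v" if "v \<in> M" for v using \<rho>[OF that] unfolding cell_def by auto
  have \<rho>F: "F (\<rho> v) = fst v" "G (\<rho> v) = fst (snd v)" "H (\<rho> v) = snd (snd v)" if "v \<in> M" for v
    using \<rho>S(2)[OF that] unfolding \<kappa> by (metis fst_conv snd_conv)+
  have "inj_on \<rho> M" using \<rho>S(2) by (metis inj_onI)
  then have cM: "card (\<rho> ` M) = card M" by (rule card_image)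
  note inc' = inc2_rotate[OF inc]
  note inc'' = inc2_rotate[OF inc']
  have "inc2 F G H (\<rho> ` M)"
    unfolding inc2_def
  proof (intro ballI impI)
    fix k k' assume "k \<in> \<rho> ` M" "k' \<in> \<rho> ` M" and less: "k < k'"
    then obtain v v' where v: "v \<in> M" "v' \<in> M" "k = \<rho> v" "k' = \<rho> v'" by auto
    have vv: "v \<noteq> v'" using v less by auto
    have kS: "k \<in> S" "k' \<in> S" using v \<rho>S by auto
    have Fk: "F k = fst v" "G k = fst (snd v)" "H k = snd (snd v)"
      "F k' = fst v'" "G k' = fst (snd v')" "H k' = snd (snd v')" using \<rho>F v by auto
    have vH: "v \<in> H3" "v' \<in> H3" using v MH by auto
    have ecell: "e \<in> S \<and> F e = F k \<and> G e = G k \<and> H e = H k" if "e \<in> cell v" for e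
      using that Fk unfolding cell_def \<kappa> by auto
    have ecell': "e \<in> S \<and> F e = F k' \<and> G e = G k' \<and> H e = H k'" if "e \<in> cell v'" for e
      using that Fk unfolding cell_def \<kappa> by auto
    \<comment> \<open>If one coarse coordinate agrees, both cells meet the slice selected there, and
      \<open>inc2_coarse_same\<close> makes the other two increase. If none agrees, the fine
      increases survive coarsening because the weak inequalities become strict.\<close>
    consider "F k = F k'" | "G k = G k'" | "H k = H k'" | "F k \<noteq> F k'" "G k \<noteq> G k'" "H k \<noteq> H k'" by blast
    then show "F k < F k' \<and> G k < G k' \<or> F k < F k' \<and> H k < H k' \<or> G k < G k' \<and> H k < H k'"
    proof cases
      case 1
      have ne: "G k \<noteq> G k'" "H k \<noteq> H k'" using 1 vv inj1[OF v(1,2)] inj3[OF v(1,2)] Fk by auto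
      have "sx (F k) \<in> f ` cell v" "sx (F k) \<in> f ` cell v'"
        using vH 1 Fk unfolding H3_def H2_def H1_def by auto
      then obtain e e' where e: "e \<in> cell v" "e' \<in> cell v'" "f e = f e'" by auto
      have ee: "e \<in> S" "G e = G k" "H e = H k" using ecell[OF e(1)] by auto
      have ee': "e' \<in> S" "G e' = G k'" "H e' = H k'" using ecell'[OF e(2)] by auto
      show ?thesis
        using inc2_coarse_same[OF inc coarseningD(2)[OF G] coarseningD(2)[OF H] ee(1) ee'(1) kS e(3) ee(2,3) ee'(2,3) less ne]
        by blast
    next
      case 2
      have ne: "H k \<noteq> H k'" "F k \<noteq> F k'" using 2 vv inj1[OF v(1,2)] inj2[OF v(1,2)] Fk by auto
      have "sy (G k) \<in> g ` cell v" "sy (G k) \<in> g ` cell v'"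
        using vH 2 Fk unfolding H3_def H2_def by auto
      then obtain e e' where e: "e \<in> cell v" "e' \<in> cell v'" "g e = g e'" by auto
      have ee: "e \<in> S" "H e = H k" "F e = F k" using ecell[OF e(1)] by auto
      have ee': "e' \<in> S" "H e' = H k'" "F e' = F k'" using ecell'[OF e(2)] by auto
      show ?thesis
        using inc2_coarse_same[OF inc' coarseningD(2)[OF H] coarseningD(2)[OF F] ee(1) ee'(1) kS e(3) ee(2,3) ee'(2,3) less ne]
        by blast
    next
      case 3
      have ne: "F k \<noteq> F k'" "G k \<noteq> G k'" using 3 vv inj2[OF v(1,2)] inj3[OF v(1,2)] Fk by auto
      have "sz (H k) \<in> h ` cell v" "sz (H k) \<in> h ` cell v'"
        using vH 3 Fk unfolding H3_def by auto
      then obtain e e' where e: "e \<in> cell v" "e' \<in> cell v'" "h e = h e'" by auto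
      have ee: "e \<in> S" "F e = F k" "G e = G k" using ecell[OF e(1)] by auto
      have ee': "e' \<in> S" "F e' = F k'" "G e' = G k'" using ecell'[OF e(2)] by auto
      show ?thesis
        using inc2_coarse_same[OF inc'' coarseningD(2)[OF F] coarseningD(2)[OF G] ee(1) ee'(1) kS e(3) ee(2,3) ee'(2,3) less ne]
        by blast
    next
      case 4
      have "f k < f k' \<and> g k < g k' \<or> f k < f k' \<and> h k < h k' \<or> g k < g k' \<and> h k < h k'"
        using inc kS less unfolding inc2_def by blast
      then show ?thesis
        using coarseningD(2)[OF F kS] coarseningD(2)[OF G kS] coarseningD(2)[OF H kS] 4
        by (meson le_neq_implies_less less_imp_le)
    qed
  qed
  moreover have "\<rho> ` M \<subseteq> S" using \<rho>S by auto
  ultimately show ?thesis using 2 cM by (intro exI[of _ "\<rho> ` M"]) simp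
qed

text \<open>\<open>S\<close> is a minimal counterexample with more than \<Phi> elements. Cells with
  a side fraction below \<epsilon> hold at most \<Phi>/2 of them, and remaining cells of size below
  \<mu> at most \<Phi>/4. So \<Phi>/4 is left for \<open>Hs\<close>, whose cells have at most
  \<open>m0\<close> elements each; this gives at least \<open>K^2 / 64\<close> cells, to which
  \<open>exists_coarse_selection\<close> applies.\<close>

lemma exists_dense_coarsening:
  fixes \<theta> C \<epsilon> :: real
  assumes fin: "finite S" and inc: "inc2 f g h S" and K: "K \<ge> 3"
    and rst: "K \<le> card (f ` S)" "K \<le> card (g ` S)" "K \<le> card (h ` S)"
    and \<theta>: "1 / 2 \<le> \<theta>" "\<theta> \<le> 2 / 3" and C: "C > 0"
    and pw: "(8 / real K ^ 3) powr \<theta> \<le> 16 / (real K)\<^sup>2"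
    and \<epsilon>: "\<epsilon> = 1 / 10000" and Q: "Q = (640000::nat) ^ 3"
    and IH: "\<And>T. T \<subset> S \<Longrightarrow> real (card T) \<le> C * (real (card (f ` T)) * real (card (g ` T)) * real (card (h ` T))) powr \<theta>"
    and big: "real (card S) > C * (real (card (f ` S)) * real (card (g ` S)) * real (card (h ` S))) powr \<theta>"
  shows "\<exists>F G H M. finite M \<and> inc2 F G H M \<and> F ` M \<subseteq> {..<K} \<and> G ` M \<subseteq> {..<K} \<and> H ` M \<subseteq> {..<K} \<and>
    \<epsilon> ^ 3 / (64 * real Q ^ 3) * (real K)\<^sup>2 \<le> real (card M)"
proof -
  define r where "r = card (f ` S)"
  define s where "s = card (g ` S)"
  define t where "t = card (h ` S)"
  define R where "R = real r * real s * real t"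
  define \<Phi> where "\<Phi> = C * R powr \<theta>"
  have pos: "r > 0" "s > 0" "t > 0" using rst K unfolding r_def s_def t_def by auto
  have ne: "S \<noteq> {}" using pos unfolding r_def by auto
  have R: "R > 0" unfolding R_def using pos by simp
  have \<Phi>: "\<Phi> > 0" unfolding \<Phi>_def using C R by simp
  have K0: "real K > 0" "K > 0" using K by auto
  have \<epsilon>0: "\<epsilon> > 0" "\<epsilon> \<le> 1" using \<epsilon> by auto
  obtain F where F: "coarsening K f F S" using exists_coarsening[OF fin K0(2) rst(1)] by blast
  obtain G where G: "coarsening K g G S" using exists_coarsening[OF fin K0(2) rst(2)] by blast
  obtain H where H: "coarsening K h H S" using exists_coarsening[OF fin K0(2) rst(3)] by blast
  note inc' = inc2_rotate[OF inc]
  note inc'' = inc2_rotate[OF inc']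
  define \<kappa> where "\<kappa> = (\<lambda>k. (F k, G k, H k))"
  define V where "V = \<kappa> ` S"
  define cell where "cell v = {k \<in> S. \<kappa> k = v}" for v
  have finV: "finite V" unfolding V_def using fin by simp
  have fincell: "finite (cell v)" for v unfolding cell_def using fin by simp
  \<comment> \<open>The fractions are normalised by the largest side \<open>2 * r / K\<close> that a
    cell can have, so they lie between 0 and 1.\<close>
  define a where "a v = real K * real (card (f ` cell v)) / (2 * real r)" for v
  define b where "b v = real K * real (card (g ` cell v)) / (2 * real s)" for v
  define c where "c v = real K * real (card (h ` cell v)) / (2 * real t)" for v
  have suma: "(\<Sum>v\<in>V. a v) \<le> (real K)\<^sup>2"
    unfolding V_def a_def cell_def r_def by (rule sum_cell_fraction_le[OF inc fin F G H]) (simp add: \<kappa>_def)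
  have sumb: "(\<Sum>v\<in>V. b v) \<le> (real K)\<^sup>2"
    unfolding V_def b_def cell_def s_def by (rule sum_cell_fraction_le[OF inc' fin G H F]) (simp add: \<kappa>_def)
  have sumc: "(\<Sum>v\<in>V. c v) \<le> (real K)\<^sup>2"
    unfolding V_def c_def cell_def t_def by (rule sum_cell_fraction_le[OF inc'' fin H F G]) (simp add: \<kappa>_def)
  have Kf: "K * card (f ` cell v) \<le> 2 * r" for v
    unfolding r_def by (rule coarsening_card_le[OF F fin, of _ "fst v"]) (auto simp: cell_def \<kappa>_def)
  have Kg: "K * card (g ` cell v) \<le> 2 * s" for v
    unfolding s_def by (rule coarsening_card_le[OF G fin, of _ "fst (snd v)"]) (auto simp: cell_def \<kappa>_def)
  have Kh: "K * card (h ` cell v) \<le> 2 * t" for v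
    unfolding t_def by (rule coarsening_card_le[OF H fin, of _ "snd (snd v)"]) (auto simp: cell_def \<kappa>_def)
  have frac: "0 \<le> real K * real x / (2 * real y) \<and> real K * real x / (2 * real y) \<le> 1"
    if "K * x \<le> 2 * y" "y > 0" for x y :: nat
  proof -
    have "real (K * x) \<le> real (2 * y)" using that by (simp only: of_nat_le_iff)
    then show ?thesis using that by simp
  qed
  have a01: "0 \<le> a v" "a v \<le> 1" for v unfolding a_def using frac[OF Kf pos(1)] by auto
  have b01: "0 \<le> b v" "b v \<le> 1" for v unfolding b_def using frac[OF Kg pos(2)] by auto
  have c01: "0 \<le> c v" "c v \<le> 1" for v unfolding c_def using frac[OF Kh pos(3)] by auto
  have abc: "0 \<le> a v * b v * c v" "a v * b v * c v \<le> 1" for v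
    using a01[of v] b01[of v] c01[of v] by (simp, intro mult_le_one mult_nonneg_nonneg)
  define m0 where "m0 = 16 * \<Phi> / (real K)\<^sup>2"
  have m0: "m0 > 0" unfolding m0_def using \<Phi> K0 by simp
  have mass: "real (card (cell v)) \<le> m0 * sqrt (a v * b v * c v)" for v
  proof -
    define p where "p = real (card (f ` cell v)) * real (card (g ` cell v)) * real (card (h ` cell v))"
    have "cell v \<noteq> S"
    proof
      assume "cell v = S"
      then have "K * r \<le> 2 * r" using Kf[of v] unfolding r_def by simp
      then show False using pos K by simp
    qed
    then have "cell v \<subset> S" unfolding cell_def by blast
    then have "real (card (cell v)) \<le> C * p powr \<theta>" unfolding p_def by (rule IH)
    also have "\<dots> \<le> C * R powr \<theta> * 16 / (real K)\<^sup>2 * (a v * b v * c v) powr \<theta>"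
    proof (rule powr_scaled_le)
      have "8 * (a v * b v * c v) * R = real K ^ 3 * p"
        unfolding a_def b_def c_def R_def p_def using pos by (simp add: field_simps power3_eq_cube)
      then show "real K ^ 3 * p \<le> 8 * (a v * b v * c v) * R" by simp
    qed (use R C \<theta> K0 pw abc in \<open>auto simp: p_def\<close>)
    also have "\<dots> = m0 * (a v * b v * c v) powr \<theta>" unfolding m0_def \<Phi>_def by simp
    \<comment> \<open>Lowering the exponent to 1/2 is an upper bound because the base is at most 1;
      it frees the estimate from \<theta>.\<close>
    also have "\<dots> \<le> m0 * sqrt (a v * b v * c v)"
    proof (rule mult_left_mono)
      have "(a v * b v * c v) powr \<theta> \<le> (a v * b v * c v) powr (1 / 2)"
        using abc[of v] \<theta> by (intro powr_mono') auto
      then show "(a v * b v * c v) powr \<theta> \<le> sqrt (a v * b v * c v)" using abc[of v] by (simp add: powr_half_sqrt)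
    qed (use m0 in simp)
    finally show ?thesis .
  qed
  have mass1: "real (card (cell v)) \<le> m0" for v
  proof -
    have "sqrt (a v * b v * c v) \<le> 1" using abc[of v] by simp
    then have "m0 * sqrt (a v * b v * c v) \<le> m0 * 1" using m0 by (intro mult_left_mono) auto
    then show ?thesis using mass[of v] by simp
  qed
  have total: "real (card S) = (\<Sum>v\<in>V. real (card (cell v)))"
  proof -
    have "S = (\<Union>v\<in>V. cell v)" unfolding V_def cell_def by auto
    also have "card \<dots> = (\<Sum>v\<in>V. card (cell v))"
      by (rule card_UN_disjoint) (use finV fincell in \<open>auto simp: cell_def\<close>)
    finally show ?thesis by simp
  qed
  define H0 where "H0 = {v \<in> V. \<epsilon> \<le> a v \<and> \<epsilon> \<le> b v \<and> \<epsilon> \<le> c v}"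
  \<comment> \<open>There are at most \<open>K^2\<close> / \<epsilon> cells in \<open>H0\<close>, so
    those of size below \<mu> have at most \<Phi>/4 elements together.\<close>
  define \<mu> where "\<mu> = \<epsilon> * \<Phi> / (4 * (real K)\<^sup>2)"
  define Hs where "Hs = {v \<in> H0. \<mu> \<le> real (card (cell v))}"
  have \<mu>0: "\<mu> > 0" unfolding \<mu>_def using \<epsilon>0 \<Phi> K0 by simp
  have light: "(\<Sum>v\<in>V - H0. real (card (cell v))) \<le> \<Phi> / 2"
  proof -
    \<comment> \<open>This fixes \<epsilon>: the three fraction sums and \<open>m0\<close> give 3 *
      16 * sqrt \<epsilon> = 48/100, just below 1/2.\<close>
    have sq: "sqrt \<epsilon> = 1 / 100" unfolding \<epsilon> by (rule real_sqrt_unique) (auto simp: power2_eq_square)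
    have "(\<Sum>v\<in>V - H0. real (card (cell v))) \<le> (\<Sum>v\<in>V - H0. m0 / 100 * (a v + b v + c v))"
    proof (rule sum_mono)
      fix v assume v: "v \<in> V - H0"
      then have "a v < \<epsilon> \<or> b v < \<epsilon> \<or> c v < \<epsilon>" unfolding H0_def by (simp add: not_le)
      then consider "a v < \<epsilon>" | "b v < \<epsilon>" | "c v < \<epsilon>" by blast
      then have "sqrt (a v * b v * c v) \<le> sqrt \<epsilon> * (a v + b v + c v)"
      proof cases
        case 1
        then show ?thesis by (intro sqrt_prod_le a01 b01 c01)
      next
        case 2
        then show ?thesis using sqrt_prod_le[OF b01(1)[of v] a01(1)[of v] c01(1)[of v]] by (simp add: mult_ac add_ac)
      next
        case 3
        then show ?thesis using sqrt_prod_le[OF c01(1)[of v] a01(1)[of v] b01(1)[of v]] by (simp add: mult_ac add_ac)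
      qed
      then have "m0 * sqrt (a v * b v * c v) \<le> m0 * (1 / 100 * (a v + b v + c v))"
        using m0 sq by (intro mult_left_mono) auto
      then show "real (card (cell v)) \<le> m0 / 100 * (a v + b v + c v)" using mass[of v] by simp
    qed
    also have "\<dots> \<le> (\<Sum>v\<in>V. m0 / 100 * (a v + b v + c v))"
      using finV m0 a01 b01 c01 by (intro sum_mono2) (auto intro!: mult_nonneg_nonneg add_nonneg_nonneg)
    also have "\<dots> = m0 / 100 * ((\<Sum>v\<in>V. a v) + (\<Sum>v\<in>V. b v) + (\<Sum>v\<in>V. c v))"
      by (simp only: sum_distrib_left[symmetric] sum.distrib)
    also have "\<dots> \<le> m0 / 100 * (3 * (real K)\<^sup>2)"
      using suma sumb sumc m0 by (intro mult_left_mono) auto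
    also have "\<dots> = 48 / 100 * \<Phi>" unfolding m0_def using K0 by simp
    finally show ?thesis using \<Phi> by simp
  qed
  have finH: "finite H0" "finite Hs" unfolding Hs_def H0_def using finV by auto
  have cardH0: "\<epsilon> * real (card H0) \<le> (real K)\<^sup>2"
  proof -
    have "\<epsilon> * real (card H0) = (\<Sum>v\<in>H0. \<epsilon>)" by simp
    also have "\<dots> \<le> (\<Sum>v\<in>H0. a v)" by (intro sum_mono) (auto simp: H0_def)
    also have "\<dots> \<le> (\<Sum>v\<in>V. a v)" using finV a01 by (intro sum_mono2) (auto simp: H0_def)
    finally show ?thesis using suma by simp
  qed
  have light2: "(\<Sum>v\<in>H0 - Hs. real (card (cell v))) \<le> \<Phi> / 4"
  proof -
    have "(\<Sum>v\<in>H0 - Hs. real (card (cell v))) \<le> (\<Sum>v\<in>H0 - Hs. \<mu>)"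
      by (intro sum_mono) (auto simp: Hs_def)
    also have "\<dots> \<le> (\<Sum>v\<in>H0. \<mu>)" using finH \<mu>0 by (intro sum_mono2) auto
    also have "\<dots> = (\<epsilon> * real (card H0)) * (\<Phi> / (4 * (real K)\<^sup>2))" unfolding \<mu>_def by simp
    also have "\<dots> \<le> (real K)\<^sup>2 * (\<Phi> / (4 * (real K)\<^sup>2))"
      using cardH0 \<Phi> by (intro mult_right_mono) auto
    also have "\<dots> = \<Phi> / 4" using K0 by simp
    finally show ?thesis .
  qed
  have "(\<Sum>v\<in>V. real (card (cell v))) = (\<Sum>v\<in>V - H0. real (card (cell v))) + (\<Sum>v\<in>H0. real (card (cell v)))"
    by (rule sum.subset_diff) (use finV in \<open>auto simp: H0_def\<close>)
  moreover have "(\<Sum>v\<in>H0. real (card (cell v))) = (\<Sum>v\<in>H0 - Hs. real (card (cell v))) + (\<Sum>v\<in>Hs. real (card (cell v)))"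
    by (rule sum.subset_diff) (use finH in \<open>auto simp: Hs_def\<close>)
  moreover have "\<Phi> < real (card S)" using big unfolding \<Phi>_def R_def r_def s_def t_def .
  ultimately have "\<Phi> / 4 \<le> (\<Sum>v\<in>Hs. real (card (cell v)))" using light light2 total by linarith
  also have "\<dots> \<le> (\<Sum>v\<in>Hs. m0)" by (intro sum_mono mass1)
  also have "\<dots> = real (card Hs) * 16 * \<Phi> / (real K)\<^sup>2" unfolding m0_def by simp
  finally have "(real K)\<^sup>2 * \<Phi> \<le> (64 * real (card Hs)) * \<Phi>" using K0 by (simp add: field_simps)
  then have cardHs: "(real K)\<^sup>2 / 64 \<le> real (card Hs)" using \<Phi> by simp
  have HsV: "Hs \<subseteq> V" unfolding Hs_def H0_def by auto
  have toQ: "x \<le> Q" if "real x \<le> (64 / \<epsilon>) ^ 3" for x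
  proof -
    have "real x \<le> real Q" using that unfolding \<epsilon> Q by simp
    then show ?thesis by simp
  qed
  have heavy: "\<epsilon> * \<Phi> / (4 * (real K)\<^sup>2) \<le> real (card {k \<in> S. \<kappa> k = v})" if "v \<in> Hs" for v
    using that unfolding Hs_def \<mu>_def cell_def by simp
  have \<theta>0: "0 \<le> \<theta>" using \<theta> by simp
  have fib1: "card {v \<in> Hs. (fst v, fst (snd v)) = y} \<le> Q" for y
    by (rule toQ, rule card_heavy_pillar_le[OF fin K ne F G H _ \<theta>0 \<theta>(2) C \<epsilon>0 pw IH, of \<kappa> \<Phi> _ "fst y" "snd y"])
      (use finH heavy in \<open>auto simp: \<kappa>_def \<Phi>_def R_def r_def s_def t_def\<close>)
  have IH': "real (card T) \<le> C * (real (card (g ` T)) * real (card (h ` T)) * real (card (f ` T))) powr \<theta>" if "T \<subset> S" for T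
    using IH[OF that] by (simp add: mult_ac)
  have fib2: "card {v \<in> Hs. (fst (snd v), snd (snd v)) = y} \<le> Q" for y
    by (rule toQ, rule card_heavy_pillar_le[OF fin K ne G H F _ \<theta>0 \<theta>(2) C \<epsilon>0 pw IH', of \<kappa> \<Phi> _ "fst y" "snd y"])
      (use finH heavy in \<open>auto simp: \<kappa>_def \<Phi>_def R_def r_def s_def t_def mult_ac\<close>)
  have IH'': "real (card T) \<le> C * (real (card (h ` T)) * real (card (f ` T)) * real (card (g ` T))) powr \<theta>" if "T \<subset> S" for T
    using IH[OF that] by (simp add: mult_ac)
  have fib3: "card {v \<in> Hs. (snd (snd v), fst v) = y} \<le> Q" for y
    by (rule toQ, rule card_heavy_pillar_le[OF fin K ne H F G _ \<theta>0 \<theta>(2) C \<epsilon>0 pw IH'', of \<kappa> \<Phi> _ "fst y" "snd y"])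
      (use finH heavy in \<open>auto simp: \<kappa>_def \<Phi>_def R_def r_def s_def t_def mult_ac\<close>)
  have dens: "\<epsilon> * real x \<le> real x'" if "K * x \<le> 2 * y" "\<epsilon> \<le> real K * real x' / (2 * real y)" "y > 0" for x x' y :: nat
  proof -
    have "real K * real x \<le> 2 * real y" using that(1) by (metis of_nat_le_iff of_nat_mult of_nat_numeral)
    then have "\<epsilon> * (real K * real x) \<le> \<epsilon> * (2 * real y)" using \<epsilon>0 by simp
    also have "\<dots> \<le> real K * real x'" using that by (simp add: field_simps)
    finally show ?thesis using K0 by (simp add: mult.left_commute)
  qed
  have "\<exists>M\<subseteq>S. inc2 F G H M \<and> \<epsilon> ^ 3 * real (card Hs) \<le> real Q ^ 3 * real (card M)"
  proof (rule exists_coarse_selection[OF inc fin F G H \<kappa>_def])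
    fix v assume v: "v \<in> Hs"
    show "\<epsilon> * real (card (f ` {k \<in> S. F k = fst v})) \<le> real (card (f ` {k \<in> S. \<kappa> k = v}))"
      by (rule dens[OF coarsening_card_le[OF F fin order_refl]]) (use v pos in \<open>auto simp: Hs_def H0_def a_def cell_def r_def\<close>)
    show "\<epsilon> * real (card (g ` {k \<in> S. G k = fst (snd v)})) \<le> real (card (g ` {k \<in> S. \<kappa> k = v}))"
      by (rule dens[OF coarsening_card_le[OF G fin order_refl]]) (use v pos in \<open>auto simp: Hs_def H0_def b_def cell_def s_def\<close>)
    show "\<epsilon> * real (card (h ` {k \<in> S. H k = snd (snd v)})) \<le> real (card (h ` {k \<in> S. \<kappa> k = v}))"
      by (rule dens[OF coarsening_card_le[OF H fin order_refl]]) (use v pos in \<open>auto simp: Hs_def H0_def c_def cell_def t_def\<close>)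
  qed (use HsV \<epsilon>0 fib1 fib2 fib3 in \<open>auto simp: V_def\<close>)
  then obtain M where M: "M \<subseteq> S" "inc2 F G H M" "\<epsilon> ^ 3 * real (card Hs) \<le> real Q ^ 3 * real (card M)" by blast
  have "\<epsilon> ^ 3 * ((real K)\<^sup>2 / 64) \<le> \<epsilon> ^ 3 * real (card Hs)"
    using cardHs \<epsilon>0 by (intro mult_left_mono) auto
  then have "\<epsilon> ^ 3 * ((real K)\<^sup>2 / 64) \<le> real Q ^ 3 * real (card M)" using M(3) by linarith
  moreover have "real Q ^ 3 > 0" unfolding Q by simp
  ultimately have "\<epsilon> ^ 3 / (64 * real Q ^ 3) * (real K)\<^sup>2 \<le> real (card M)"
    by (simp add: field_simps)
  moreover have "finite M" using M(1) fin finite_subset by blast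
  moreover have "F ` M \<subseteq> {..<K}" "G ` M \<subseteq> {..<K}" "H ` M \<subseteq> {..<K}"
    using M(1) coarseningD(1)[OF F] coarseningD(1)[OF G] coarseningD(1)[OF H] by auto
  ultimately show ?thesis using M(2) by blast
qed

section \<open>The power bound with a constant, by induction\<close>

lemma inc2_card_le_mult:
  assumes "inc2 f g h S" "finite S"
  shows "card S \<le> card (f ` S) * card (g ` S)"
proof -
  have "inj_on (\<lambda>k. (f k, g k)) S"
    using inc2_eq[OF assms(1)] by (auto intro: inj_onI)
  then have "card S = card ((\<lambda>k. (f k, g k)) ` S)" by (simp add: card_image)
  also have "\<dots> \<le> card (f ` S \<times> g ` S)"
    using assms(2) by (intro card_mono) auto
  finally show ?thesis by (simp add: card_cartesian_product)
qed

text \<open>The geometric mean of the two bounds on \<open>m\<close> is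
  \<open>r * sqrt (s * t)\<close>, at most \<open>K\<close> times the square root of the product of
  all sides. It settles the case of a side with fewer than \<open>K\<close> values.\<close>

lemma le_powr_if_thin:
  fixes \<theta> :: real
  assumes "m \<le> r * s" "m \<le> r * t" "r \<le> K" "r > 0" "s > 0" "t > 0" "1 / 2 \<le> \<theta>"
  shows "real m \<le> real K * (real r * real s * real t) powr \<theta>"
proof -
  have "m * m \<le> (r * s) * (r * t)" using assms by (intro mult_le_mono)
  also have "\<dots> = (r * r) * (s * t)" by (simp add: mult_ac)
  also have "\<dots> \<le> (K * K) * (r * s * t)" using assms by (intro mult_le_mono) auto
  finally have "real (m * m) \<le> real ((K * K) * (r * s * t))" by (simp only: of_nat_le_iff)
  then have "(real m)\<^sup>2 \<le> (real K)\<^sup>2 * (real r * real s * real t)" by (simp add: power2_eq_square)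
  then have "sqrt ((real m)\<^sup>2) \<le> sqrt ((real K)\<^sup>2 * (real r * real s * real t))" by (rule real_sqrt_le_mono)
  then have 1: "real m \<le> real K * sqrt (real r * real s * real t)" by (simp add: real_sqrt_mult)
  have "r * s * t \<ge> 1" using assms(4-6) by (simp add: Suc_le_eq)
  then have "real (r * s * t) \<ge> 1" by linarith
  then have ge: "real r * real s * real t \<ge> 1" by simp
  then have "sqrt (real r * real s * real t) = (real r * real s * real t) powr (1 / 2)" by (simp add: powr_half_sqrt)
  also have "\<dots> \<le> (real r * real s * real t) powr \<theta>" by (rule powr_mono[OF assms(7) ge])
  finally have "real K * sqrt (real r * real s * real t) \<le> real K * (real r * real s * real t) powr \<theta>"
    by (intro mult_left_mono) auto
  then show ?thesis using 1 by linarith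
qed

text \<open>With \<open>y = 2 / K\<close> the left side is \<open>y powr (2 - 1 / K)\<close>, that
  is \<open>4 / K^2\<close> times the \<open>K\<close>-th root of \<open>K / 2\<close>, and this
  root is at most 2. So an exponent this close to 2/3 costs only a constant factor.\<close>

lemma powr_cube_bound:
  assumes "K > 0"
  shows "(8 / real K ^ 3) powr (2 / 3 - 1 / (3 * real K)) \<le> 16 / (real K)\<^sup>2"
proof -
  define y where "y = 2 / real K"
  have y: "y > 0" unfolding y_def using assms by simp
  have "8 / real K ^ 3 = y ^ 3" unfolding y_def by (simp add: power_divide)
  also have "\<dots> = y powr 3" using y by (simp add: powr_numeral)
  finally have "(8 / real K ^ 3) powr (2 / 3 - 1 / (3 * real K)) = y powr (3 * (2 / 3 - 1 / (3 * real K)))"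
    by (simp only: powr_powr)
  also have "3 * (2 / 3 - 1 / (3 * real K)) = 2 + - (1 / real K)" using assms by (simp add: field_simps)
  also have "y powr (2 + - (1 / real K)) = y powr 2 * y powr (- (1 / real K))" by (rule powr_add)
  also have "y powr 2 = 4 / (real K)\<^sup>2" using y unfolding y_def by (simp add: powr_numeral power_divide)
  also have "y powr (- (1 / real K)) = (real K / 2) powr (1 / real K)"
    unfolding y_def using assms by (simp add: powr_minus powr_divide)
  also have "(4 / (real K)\<^sup>2) * (real K / 2) powr (1 / real K) \<le> (4 / (real K)\<^sup>2) * 2"
  proof (rule mult_left_mono)
    have "real K / 2 \<le> 2 ^ K" using of_nat_less_two_power[of K, where 'a = real] by linarith
    then have "(real K / 2) powr (1 / real K) \<le> (2 ^ K) powr (1 / real K)" by (intro powr_mono2) auto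
    also have "\<dots> = (2 powr real K) powr (1 / real K)" by (simp add: powr_realpow)
    also have "\<dots> = 2" using assms by (simp add: powr_powr)
    finally show "(real K / 2) powr (1 / real K) \<le> 2" .
  qed simp
  also have "\<dots> \<le> 16 / (real K)\<^sup>2" by (simp add: divide_right_mono)
  finally show ?thesis .
qed

lemma inc2_card_le_powr:
  "\<exists>\<theta> C :: real. 1 / 2 \<le> \<theta> \<and> \<theta> < 2 / 3 \<and> C > 0 \<and> (\<forall>f g h S. finite S \<longrightarrow> inc2 f g h S \<longrightarrow>
     real (card S) \<le> C * (real (card (f ` S)) * real (card (g ` S)) * real (card (h ` S))) powr \<theta>)"
proof -
  define \<epsilon> :: real where "\<epsilon> = 1 / 10000"
  define Q :: nat where "Q = 640000 ^ 3"
  define c where "c = \<epsilon> ^ 3 / (64 * real Q ^ 3)"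
  have c: "c > 0" unfolding c_def \<epsilon>_def Q_def by simp
  obtain N where "\<forall>n\<ge>N. \<forall>f g h S. finite S \<longrightarrow> inc2 f g h S \<longrightarrow> f ` S \<subseteq> {..<n} \<longrightarrow> g ` S \<subseteq> {..<n} \<longrightarrow>
      h ` S \<subseteq> {..<n} \<longrightarrow> real (card S) < c * (real n)\<^sup>2"
    using inc2_card_subquadratic[OF c] by (elim exE)
  note N = this[rule_format]
  \<comment> \<open>The grid size is fixed first, by the density \<open>c\<close> to be
    contradicted; it then determines both the exponent \<theta> and the constant, which is
    \<open>K\<close> itself.\<close>
  define K where "K = max N 3"
  have K: "K \<ge> 3" "K \<ge> N" unfolding K_def by auto
  define \<theta> where "\<theta> = 2 / 3 - 1 / (3 * real K)"
  have "1 / (3 * real K) \<le> 1 / 9" using K by (simp add: field_simps)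
  moreover have "1 / (3 * real K) > 0" using K by simp
  ultimately have \<theta>: "1 / 2 \<le> \<theta>" "\<theta> < 2 / 3" unfolding \<theta>_def by linarith+
  have pw: "(8 / real K ^ 3) powr \<theta> \<le> 16 / (real K)\<^sup>2" unfolding \<theta>_def by (rule powr_cube_bound) (use K in simp)
  have "real (card S) \<le> real K * (real (card (f ` S)) * real (card (g ` S)) * real (card (h ` S))) powr \<theta>"
    if "finite S" "inc2 f g h S" for f g h S
    using that
  proof (induction S rule: finite_psubset_induct)
    case (psubset S)
    note fin = \<open>finite S\<close> and inc = \<open>inc2 f g h S\<close>
    note inc' = inc2_rotate[OF inc]
    note inc'' = inc2_rotate[OF inc']
    define r where "r = card (f ` S)"
    define s where "s = card (g ` S)"
    define t where "t = card (h ` S)"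
    have bd: "card S \<le> r * s" "card S \<le> s * t" "card S \<le> t * r"
      using inc2_card_le_mult[OF inc fin] inc2_card_le_mult[OF inc' fin] inc2_card_le_mult[OF inc'' fin]
      unfolding r_def s_def t_def by auto
    show ?case
    proof (cases "S = {}")
      case True
      show ?thesis unfolding True by simp
    next
      case False
      have pos: "r > 0" "s > 0" "t > 0" unfolding r_def s_def t_def using False fin by (simp_all add: card_gt_0_iff)
      consider "r < K" | "s < K" | "t < K" | "K \<le> r" "K \<le> s" "K \<le> t" by linarith
      then have "real (card S) \<le> real K * (real r * real s * real t) powr \<theta>"
      proof cases
        case 1
        have "card S \<le> r * t" using bd(3) by (simp add: mult.commute)
        then show ?thesis using le_powr_if_thin[OF bd(1) _ _ pos \<theta>(1), of K] 1 by simp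
      next
        case 2
        have "card S \<le> s * r" using bd(1) by (simp add: mult.commute)
        then show ?thesis using le_powr_if_thin[OF bd(2) _ _ pos(2,3,1) \<theta>(1), of K] 2 by (simp add: mult_ac)
      next
        case 3
        have "card S \<le> t * s" using bd(2) by (simp add: mult.commute)
        then show ?thesis using le_powr_if_thin[OF bd(3) _ _ pos(3,1,2) \<theta>(1), of K] 3 by (simp add: mult_ac)
      next
        case 4
        show ?thesis
        proof (rule ccontr)
          assume "\<not> ?thesis"
          then have big: "real (card S) > real K * (real (card (f ` S)) * real (card (g ` S)) * real (card (h ` S))) powr \<theta>"
            unfolding r_def s_def t_def by simp
          have IH: "real (card T) \<le> real K * (real (card (f ` T)) * real (card (g ` T)) * real (card (h ` T))) powr \<theta>"
            if "T \<subset> S" for T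
            by (rule psubset.IH[OF that]) (rule inc2_subset[OF inc psubset_imp_subset[OF that]])
          have "\<exists>F G H M. finite M \<and> inc2 F G H M \<and> F ` M \<subseteq> {..<K} \<and> G ` M \<subseteq> {..<K} \<and> H ` M \<subseteq> {..<K} \<and>
              \<epsilon> ^ 3 / (64 * real Q ^ 3) * (real K)\<^sup>2 \<le> real (card M)"
            by (rule exists_dense_coarsening[OF fin inc K(1) _ _ _ \<theta>(1) less_imp_le[OF \<theta>(2)] _ pw \<epsilon>_def Q_def IH big])
              (use 4 K in \<open>simp_all add: r_def s_def t_def\<close>)
          then obtain F G H M where M: "finite M" "inc2 F G H M" "F ` M \<subseteq> {..<K}" "G ` M \<subseteq> {..<K}" "H ` M \<subseteq> {..<K}"
              "c * (real K)\<^sup>2 \<le> real (card M)"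
            unfolding c_def by (elim exE conjE)
          show False using N[OF K(2) M(1-5)] M(6) by linarith
        qed
      qed
      then show ?thesis unfolding r_def s_def t_def .
    qed
  qed
  moreover have "real K > 0" using K by simp
  ultimately show ?thesis using \<theta> by (intro exI[of _ \<theta>] exI[of _ "real K"] conjI allI impI)
qed

section \<open>Removing the constant\<close>

text \<open>Indices and coordinates are both ordered lexicographically. If the leading indices
  differ, two leading coordinates increase, and the trailing ones cannot undo this as they are below
  \<open>r'\<close>, \<open>s'\<close>, \<open>t'\<close>; if they agree, the trailing sequence
  decides.\<close>

lemma inc2_product:
  assumes a: "inc2 f g h {..<m}" and b: "inc2 f' g' h' {..<m'}"
    and bd: "\<And>i. i < m' \<Longrightarrow> f' i < r' \<and> g' i < s' \<and> h' i < t'"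
  shows "inc2 (\<lambda>k. f (k div m') * r' + f' (k mod m')) (\<lambda>k. g (k div m') * s' + g' (k mod m'))
    (\<lambda>k. h (k div m') * t' + h' (k mod m')) {..<m * m'}"
  unfolding inc2_def
proof (intro ballI impI)
  fix i j assume i: "i \<in> {..<m * m'}" and j: "j \<in> {..<m * m'}" and ij: "i < j"
  have m': "m' > 0" using i by (cases m') auto
  have lex: "x * R + u < y * R + v" if "x < y" "u < R" for x y u v R :: nat
  proof -
    have "x * R + u < (x + 1) * R" using that by simp
    also have "\<dots> \<le> y * R" using that by (intro mult_le_mono1) simp
    finally show ?thesis by simp
  qed
  have bi: "f' (i mod m') < r'" "g' (i mod m') < s'" "h' (i mod m') < t'" using bd[of "i mod m'"] m' by auto
  have dm: "i div m' < m" "j div m' < m" using i j m' by (auto simp: div_less_iff_less_mult)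
  show "f (i div m') * r' + f' (i mod m') < f (j div m') * r' + f' (j mod m') \<and>
         g (i div m') * s' + g' (i mod m') < g (j div m') * s' + g' (j mod m') \<or>
        f (i div m') * r' + f' (i mod m') < f (j div m') * r' + f' (j mod m') \<and>
         h (i div m') * t' + h' (i mod m') < h (j div m') * t' + h' (j mod m') \<or>
        g (i div m') * s' + g' (i mod m') < g (j div m') * s' + g' (j mod m') \<and>
         h (i div m') * t' + h' (i mod m') < h (j div m') * t' + h' (j mod m')"
  proof (cases "i div m' = j div m'")
    case True
    then have "i mod m' < j mod m'" using ij by (metis div_mult_mod_eq nat_add_left_cancel_less)
    then have "f' (i mod m') < f' (j mod m') \<and> g' (i mod m') < g' (j mod m') \<or>
        f' (i mod m') < f' (j mod m') \<and> h' (i mod m') < h' (j mod m') \<or>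
        g' (i mod m') < g' (j mod m') \<and> h' (i mod m') < h' (j mod m')"
      using b m' unfolding inc2_def by simp
    then show ?thesis unfolding True by simp
  next
    case False
    then have "i div m' < j div m'" using ij div_le_mono[of i j m'] by simp
    then have "f (i div m') < f (j div m') \<and> g (i div m') < g (j div m') \<or>
        f (i div m') < f (j div m') \<and> h (i div m') < h (j div m') \<or>
        g (i div m') < g (j div m') \<and> h (i div m') < h (j div m')"
      using a dm unfolding inc2_def by simp
    then show ?thesis using lex bi by metis
  qed
qed

lemma inc2_power:
  assumes a: "inc2 f g h {..<m}" and bd: "\<And>i. i < m \<Longrightarrow> f i < r \<and> g i < s \<and> h i < t"
  shows "\<exists>F G H. inc2 F G H {..<m ^ k} \<and> (\<forall>i<m ^ k. F i < r ^ k \<and> G i < s ^ k \<and> H i < t ^ k)"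
proof (induction k)
  case 0
  have "inc2 (\<lambda>_. 0) (\<lambda>_. 0) (\<lambda>_. 0) {..<m ^ 0}" unfolding inc2_def by simp
  then show ?case by (intro exI[of _ "\<lambda>_. 0"]) simp
next
  case (Suc k)
  then obtain F G H where F: "inc2 F G H {..<m ^ k}" "\<And>i. i < m ^ k \<Longrightarrow> F i < r ^ k \<and> G i < s ^ k \<and> H i < t ^ k"
    by blast
  have bound: "x * R + u < y * R" if "x < y" "u < R" for x y u R :: nat
  proof -
    have "x * R + u < (x + 1) * R" using that by simp
    also have "\<dots> \<le> y * R" using that by (intro mult_le_mono1) simp
    finally show ?thesis .
  qed
  have "f (i div m ^ k) * r ^ k + F (i mod m ^ k) < r ^ Suc k \<and> g (i div m ^ k) * s ^ k + G (i mod m ^ k) < s ^ Suc k \<and>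
      h (i div m ^ k) * t ^ k + H (i mod m ^ k) < t ^ Suc k" if i: "i < m * m ^ k" for i
  proof -
    have "m ^ k > 0" using i by (metis gr0I mult_0_right not_less0)
    then have "i div m ^ k < m" "i mod m ^ k < m ^ k" using i by (auto simp: div_less_iff_less_mult)
    then show ?thesis using bd F(2) bound by (metis power_Suc)
  qed
  then show ?case
    using inc2_product[OF a F] unfolding power_Suc by blast
qed

theorem theorem2p1:
  "\<exists>\<theta>::real. \<theta> < 2 / 3 \<and>
     (\<forall>(r::int) (s::int) (t::int) (xs::triple list).
        r > 0 \<longrightarrow> s > 0 \<longrightarrow> t > 0 \<longrightarrow>
        set xs \<subseteq> {1..r} \<times> {1..s} \<times> {1..t} \<longrightarrow> two_increasing xs \<longrightarrow>
        real (length xs) \<le> real_of_int (r * s * t) powr \<theta>)"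
proof -
  obtain \<theta> C :: real where \<theta>: "1 / 2 \<le> \<theta>" "\<theta> < 2 / 3" and C: "C > 0"
    and bound: "\<And>f g h S. finite S \<Longrightarrow> inc2 f g h S \<Longrightarrow>
      real (card S) \<le> C * (real (card (f ` S)) * real (card (g ` S)) * real (card (h ` S))) powr \<theta>"
    using inc2_card_le_powr by metis
  have "real (length xs) \<le> real_of_int (r * s * t) powr \<theta>"
    if pos: "r > 0" "s > 0" "t > 0" and xs: "set xs \<subseteq> {1..r} \<times> {1..s} \<times> {1..t}" and inc: "two_increasing xs"
    for r s t :: int and xs :: "triple list"
  proof (rule ccontr)
    define X where "X = real_of_int (r * s * t) powr \<theta>"
    define m where "m = length xs"
    assume "\<not> real (length xs) \<le> real_of_int (r * s * t) powr \<theta>"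
    then have mX: "X < real m" unfolding X_def m_def by simp
    have X: "X > 0" unfolding X_def using pos by simp
    \<comment> \<open>Coordinates start at 1; the shift puts them below \<open>r\<close>,
      \<open>s\<close>, \<open>t\<close>, as digits for \<open>inc2_power\<close>.\<close>
    define f where "f k = nat (fst (xs ! k) - 1)" for k
    define g where "g k = nat (fst (snd (xs ! k)) - 1)" for k
    define h where "h k = nat (snd (snd (xs ! k)) - 1)" for k
    have el: "xs ! k \<in> {1..r} \<times> {1..s} \<times> {1..t}" if "k < m" for k
      using xs that unfolding m_def by (meson nth_mem subsetD)
    have bd: "f k < nat r \<and> g k < nat s \<and> h k < nat t" if "k < m" for k
      using el[OF that] unfolding f_def g_def h_def by auto
    have inc2: "inc2 f g h {..<m}"
      unfolding inc2_def
    proof (intro ballI impI)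
      fix i j assume "i \<in> {..<m}" "j \<in> {..<m}" "i < j"
      then have ij: "i < m" "j < m" and "xs ! i <\<^sub>2 xs ! j"
        using inc unfolding two_increasing_def m_def by auto
      then show "f i < f j \<and> g i < g j \<or> f i < f j \<and> h i < h j \<or> g i < g j \<and> h i < h j"
        using el[OF ij(1)] el[OF ij(2)] unfolding f_def g_def h_def
        by (cases "xs ! i", cases "xs ! j") (auto simp: less2_iff)
    qed
    \<comment> \<open>The \<open>k\<close>-th lexicographic power has \<open>m ^ k\<close> elements,
      while the bound for it is \<open>C * X ^ k\<close>. Since \<open>m / X > 1\<close>, this fails
      for large \<open>k\<close>.\<close>
    have "(real m / X) ^ k \<le> C" for k
    proof -
      obtain F G H where F: "inc2 F G H {..<m ^ k}"
        "\<forall>i<m ^ k. F i < nat r ^ k \<and> G i < nat s ^ k \<and> H i < nat t ^ k"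
        using inc2_power[OF inc2 bd, of k] by blast
      have cF: "card (F ` {..<m ^ k}) \<le> nat r ^ k" "card (G ` {..<m ^ k}) \<le> nat s ^ k" "card (H ` {..<m ^ k}) \<le> nat t ^ k"
        using card_mono[of "{..<nat r ^ k}" "F ` {..<m ^ k}"] card_mono[of "{..<nat s ^ k}" "G ` {..<m ^ k}"]
          card_mono[of "{..<nat t ^ k}" "H ` {..<m ^ k}"] F(2) by auto
      have "card (F ` {..<m ^ k}) * card (G ` {..<m ^ k}) * card (H ` {..<m ^ k}) \<le> nat r ^ k * nat s ^ k * nat t ^ k"
        by (intro mult_le_mono cF)
      then have "real (card (F ` {..<m ^ k}) * card (G ` {..<m ^ k}) * card (H ` {..<m ^ k})) \<le> real (nat r ^ k * nat s ^ k * nat t ^ k)"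
        by (simp only: of_nat_le_iff)
      then have le: "real (card (F ` {..<m ^ k})) * real (card (G ` {..<m ^ k})) * real (card (H ` {..<m ^ k})) \<le>
          real_of_int (r * s * t) ^ k"
        using pos by (simp add: power_mult_distrib)
      have "real m ^ k = real (card {..<m ^ k})" by simp
      also have "\<dots> \<le> C * (real (card (F ` {..<m ^ k})) * real (card (G ` {..<m ^ k})) * real (card (H ` {..<m ^ k}))) powr \<theta>"
        by (rule bound[OF _ F(1)]) simp
      also have "\<dots> \<le> C * (real_of_int (r * s * t) ^ k) powr \<theta>"
        using C \<theta> le by (intro mult_left_mono powr_mono2) auto
      also have "(real_of_int (r * s * t) ^ k) powr \<theta> = X ^ k"
        unfolding X_def using pos by (simp add: powr_powr powr_realpow[symmetric] mult.commute)
      finally show ?thesis using X by (simp add: power_divide divide_le_eq)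
    qed
    moreover obtain k where "C < (real m / X) ^ k"
      using real_arch_pow[of "real m / X" C] mX X by auto
    ultimately show False by (meson not_le)
  qed
  then show ?thesis using \<theta>(2) by blast
qed

end
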